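(* Let $g\in L^\infty(\bar\Omega)$ be nonnegative, let $f_1,\dots,f_N>0$ ($N\ge 2$) satisfy $\int_{\bar\Omega} g(x)\,dx=f_1+\cdots+f_N$, and let $m_1,\dots,m_N\in\bar\Omega^*$ be distinct. Put $f_o=\min_{1\le i\le N}f_i$, let $\epsilon>0$, and let $\delta$ satisfy $0<\delta<f_o/N$ and $\delta\le \epsilon/N$. Let $\mathbf b^0=(1,b_2^0,\dots,b_N^0)\in W$. Then the iterative scheme with parameter $\delta$ (described in the context) started at $\mathbf b^{1,1}=\mathbf b^0$ can always be carried out (all the required decreased coordinates exist, and all vectors produced belong to $W$), and for every sequence $\mathbf b^{n,j}$ ($n\ge 1$, $1\le j\le N$) produced by it: (a) There is an $n$ with $\mathbf b^{n,1}=\mathbf b^{n,2}=\cdots=\mathbf b^{n,N}=:\mathbf b$, that is, the scheme stops after finitely many steps; and for any such $n$ the refractor $\mathcal R(\mathbf b)$ satisfies $$|G_{\mathcal R(\mathbf b)}(m_i)-f_i|\le \epsilon,\qquad 1\le i\le N.$$ (b) There is a constant $C$, depending only on $\kappa$ and the angles between the directions $m_1,\dots,m_N$, such that the sequence $\mathbf b^{n,j}$ is constant for all $n\ge n_0$, for some nonnegative integer $n_0$ satisfying $$n_0\le N\,\frac{(1+\kappa)\,C\,(\sup_\Omega g)\,(N-1)}{\delta}\,\max_{2\le j\le N}\Big(b_j^0-\frac1{1+\kappa}\Big).$$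
   Context: Setting: $0<\kappa<1$ is fixed. $S^2$ is the unit sphere in $\mathbb R^3$, $dx$ denotes surface measure, and $\Omega,\Omega^*\subset S^2$ are domains with $\inf_{m\in\bar\Omega^*,\,x\in\bar\Omega} m\cdot x\ge\kappa$, the boundary of $\Omega$ having surface measure zero. $\sup_\Omega g$ is understood as the essential supremum. Semi-ellipsoids: for $m\in S^2$, $b>0$, $E(m,b)=\{\rho(x)x:\rho(x)=\frac{b}{1-\kappa m\cdot x},\ x\in S^2,\ m\cdot x\ge\kappa\}$. Refractors: a surface $\mathcal R=\{\rho(x)x:x\in\bar\Omega\}$ is a refractor from $\bar\Omega$ to $\bar\Omega^*$ if for every $x_o\in\bar\Omega$ there are $m\in\bar\Omega^*$, $b>0$ with $\rho(x_o)=\frac{b}{1-\kappa m\cdot x_o}$ and $\rho(x)\le\frac{b}{1-\kappa m\cdot x}$ for all $x\in\bar\Omega$; then $E(m,b)$ is said to support $\mathcal R$ at $x_o$. Tracing map and refractor measure: $\mathcal T_{\mathcal R}(m)=\{x\in\bar\Omega: E(m,b)\text{ supports }\mathcal R\text{ at }x\text{ for some }b>0\}$ for $m\in\bar\Omega^*$, $\mathcal T_{\mathcal R}(\omega)=\bigcup_{m\in\omega}\mathcal T_{\mathcal R}(m)$, and $G_{\mathcal R}(\omega)=\int_{\mathcal T_{\mathcal R}(\omega)}g(x)\,dx$ for Borel $\omega\subset\bar\Omega^*$; $G_{\mathcal R}(m)$ means $G_{\mathcal R}(\{m\})$. For $\mathbf b=(b_1,\dots,b_N)$ with all $b_i>0$,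 $\mathcal R(\mathbf b)=\{\rho(x)x:x\in\bar\Omega,\ \rho(x)=\min_{1\le i\le N}\frac{b_i}{1-\kappa m_i\cdot x}\}$. Admissible vectors: $W=\{\mathbf b=(1,b_2,\dots,b_N): b_i>0\text{ and }G_{\mathcal R(\mathbf b)}(m_i)\le f_i+\delta\text{ for }i=2,\dots,N\}$. Iterative scheme with parameter $\delta$: Group $n$ ($n\ge1$) consists of vectors $\mathbf b^{n,1},\dots,\mathbf b^{n,N}\in W$. The first vector of group 1 is the starting vector in $W$, and $\mathbf b^{n+1,1}=\mathbf b^{n,N}$. Within group $n$, for $j=2,\dots,N$ successively: if $f_j-\delta\le G_{\mathcal R(\mathbf b^{n,j-1})}(m_j)\le f_j+\delta$, set $\mathbf b^{n,j}=\mathbf b^{n,j-1}$; otherwise (then $G_{\mathcal R(\mathbf b^{n,j-1})}(m_j)<f_j-\delta$, since $\mathbf b^{n,j-1}\in W$) let $\mathbf b^{n,j}$ be a vector obtained from $\mathbf b^{n,j-1}$ by replacing its $j$-th coordinate by a strictly smaller positive number, all other coordinates being unchanged, so that $f_j\le G_{\mathcal R(\mathbf b^{n,j})}(m_j)\le f_j+\delta$. *)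

theory Defs
  imports "HOL-Analysis.Analysis" "HOL-Probability.Essential_Supremum"
begin

abbreviation S2 :: "(real^3) set" where
  "S2 \<equiv> sphere 0 1"

(* Surface measure on the unit sphere, defined by polar coordinates: the measure of A is
   3 * Leb {t x | 0 < t \<le> 1, x in A}. It is completed, so that "measurable" on the sphere means
   Lebesgue measurable. Here sgn y = y / |y|. *)
definition sphere_measure :: "(real^3) measure" where
  "sphere_measure = completion (scale_measure 3
     (distr (restrict_space lborel (cball 0 1 - {0})) (restrict_space borel S2) sgn))"

lemma space_sphere_measure: "space sphere_measure = S2"
  by (simp add: sphere_measure_def space_restrict_space space_scale_measure)

lemma emeasure_sphere_measure:
  assumes "A \<in> sets borel" "A \<subseteq> S2"
  shows "emeasure sphere_measure A = 3 * emeasure lborel {y \<in> cball 0 1 - {0}. sgn y \<in> A}"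
proof -
  have A: "A \<in> sets (restrict_space borel S2)"
    using assms by (simp add: sets_restrict_space_iff)
  have "(\<lambda>y. y /\<^sub>R norm y) \<in> restrict_space lborel (cball 0 1 - {0}) \<rightarrow>\<^sub>M (borel :: (real^3) measure)"
    by (intro measurable_restrict_space1) measurable
  then have m: "sgn \<in> restrict_space lborel (cball 0 1 - {0}) \<rightarrow>\<^sub>M restrict_space borel S2"
    unfolding sgn_div_norm[abs_def]
    by (intro measurable_restrict_space2) (auto simp: space_restrict_space)
  have "emeasure sphere_measure A =
      3 * emeasure (distr (restrict_space lborel (cball 0 1 - {0})) (restrict_space borel S2) sgn) A"
    using A by (simp add: sphere_measure_def)
  also have "\<dots> = 3 * emeasure (restrict_space lborel (cball 0 1 - {0}))
      (sgn -` A \<inter> space (restrict_space lborel (cball 0 1 - {0})))"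
    by (simp add: emeasure_distr[OF m A])
  also have "\<dots> = 3 * emeasure lborel (sgn -` A \<inter> space (restrict_space lborel (cball 0 1 - {0})))"
    by (subst emeasure_restrict_space) (auto simp: space_restrict_space)
  also have "sgn -` A \<inter> space (restrict_space lborel (cball 0 1 - {0}))
      = {y \<in> cball 0 1 - {0}. sgn y \<in> A}"
    by (auto simp: space_restrict_space)
  finally show ?thesis .
qed

(* The total area is 4 pi, as it should be. *)
lemma emeasure_sphere_measure_S2: "emeasure sphere_measure S2 = ennreal (4 * pi)"
proof -
  have "{y \<in> cball 0 1 - {0}. sgn y \<in> S2} = cball (0::real^3) 1 - {0}"
    by (auto simp: norm_sgn)
  then have "emeasure sphere_measure S2 = 3 * emeasure lborel (cball (0::real^3) 1 - {0})"
    by (simp add: emeasure_sphere_measure)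
  also have "emeasure lborel (cball (0::real^3) 1 - {0}) = emeasure lborel (cball (0::real^3) 1)"
    by (rule emeasure_Diff_null_set) auto
  also have "\<dots> = ennreal (4 / 3 * pi)"
    by (simp add: emeasure_cball eval_unit_ball_vol)
  also have "3 * ennreal (4 / 3 * pi) = ennreal (4 * pi)"
    by (subst ennreal_numeral[symmetric], subst ennreal_mult[symmetric]) auto
  finally show ?thesis .
qed

definition sphere_domain :: "(real^3) set \<Rightarrow> bool" where
  "sphere_domain U \<longleftrightarrow> openin (top_of_set S2) U \<and> connected U \<and> U \<noteq> {}"

definition refraction_domains :: "real \<Rightarrow> (real^3) set \<Rightarrow> (real^3) set \<Rightarrow> bool" where
  "refraction_domains \<kappa> \<Omega> \<Omega>' \<longleftrightarrow>
     sphere_domain \<Omega> \<and> sphere_domain \<Omega>' \<and>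
     (INF (m, x) \<in> closure \<Omega>' \<times> closure \<Omega>. m \<bullet> x) \<ge> \<kappa> \<and>
     (top_of_set S2) frontier_of \<Omega> \<in> null_sets sphere_measure"

definition ess_bounded :: "'a measure \<Rightarrow> ('a \<Rightarrow> real) \<Rightarrow> bool" where
  "ess_bounded M g \<longleftrightarrow> g \<in> borel_measurable M \<and> esssup M (\<lambda>x. ereal \<bar>g x\<bar>) < \<infinity>"

definition ess_sup_on :: "(real^3) set \<Rightarrow> (real^3 \<Rightarrow> real) \<Rightarrow> real" where
  "ess_sup_on U g = real_of_ereal (esssup (restrict_space sphere_measure U) (\<lambda>x. ereal (g x)))"

(* A surface {\<rho>(x) x | x in closure \<Omega>} is represented by its radial function \<rho>, of which only
   the values on closure \<Omega> matter. The next function is the radial function of E(m,b); the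
   constraint m . x \<ge> \<kappa> holds automatically for x in closure \<Omega>, m in closure \<Omega>'. *)
definition ell_radius :: "real \<Rightarrow> real^3 \<Rightarrow> real \<Rightarrow> real^3 \<Rightarrow> real" where
  "ell_radius \<kappa> m b x = b / (1 - \<kappa> * (m \<bullet> x))"

definition supports ::
  "real \<Rightarrow> (real^3) set \<Rightarrow> real^3 \<Rightarrow> real \<Rightarrow> (real^3 \<Rightarrow> real) \<Rightarrow> real^3 \<Rightarrow> bool" where
  "supports \<kappa> \<Omega> m b \<rho> x0 \<longleftrightarrow>
     \<rho> x0 = ell_radius \<kappa> m b x0 \<and> (\<forall>x\<in>closure \<Omega>. \<rho> x \<le> ell_radius \<kappa> m b x)"

definition is_refractor ::
  "real \<Rightarrow> (real^3) set \<Rightarrow> (real^3) set \<Rightarrow> (real^3 \<Rightarrow> real) \<Rightarrow> bool" where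
  "is_refractor \<kappa> \<Omega> \<Omega>' \<rho> \<longleftrightarrow>
     (\<forall>x0\<in>closure \<Omega>. \<exists>m\<in>closure \<Omega>'. \<exists>b>0. supports \<kappa> \<Omega> m b \<rho> x0)"

definition tracing :: "real \<Rightarrow> (real^3) set \<Rightarrow> (real^3 \<Rightarrow> real) \<Rightarrow> real^3 \<Rightarrow> (real^3) set" where
  "tracing \<kappa> \<Omega> \<rho> m = {x \<in> closure \<Omega>. \<exists>b>0. supports \<kappa> \<Omega> m b \<rho> x}"

definition refractor_measure ::
  "real \<Rightarrow> (real^3) set \<Rightarrow> (real^3 \<Rightarrow> real) \<Rightarrow> (real^3 \<Rightarrow> real) \<Rightarrow> (real^3) set \<Rightarrow> real" where
  "refractor_measure \<kappa> \<Omega> g \<rho> \<omega> =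
     set_lebesgue_integral sphere_measure (\<Union>m\<in>\<omega>. tracing \<kappa> \<Omega> \<rho> m) g"

(* Families indexed by 1..N are functions on nat of which only the values on {1..N} matter; the
   vectors b of the scheme are moreover extensional (undefined outside {1..N}), so that equality
   of vectors is ordinary equality. *)
definition poly_refractor ::
  "real \<Rightarrow> nat \<Rightarrow> (nat \<Rightarrow> real^3) \<Rightarrow> (nat \<Rightarrow> real) \<Rightarrow> real^3 \<Rightarrow> real" where
  "poly_refractor \<kappa> N m b x = (MIN i\<in>{1..N}. ell_radius \<kappa> (m i) (b i) x)"

definition G_poly ::
  "real \<Rightarrow> (real^3) set \<Rightarrow> (real^3 \<Rightarrow> real) \<Rightarrow> nat \<Rightarrow> (nat \<Rightarrow> real^3) \<Rightarrow> (nat \<Rightarrow> real) \<Rightarrow> nat \<Rightarrow> real"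
  where
  "G_poly \<kappa> \<Omega> g N m b i = refractor_measure \<kappa> \<Omega> g (poly_refractor \<kappa> N m b) {m i}"

definition admissible ::
  "real \<Rightarrow> (real^3) set \<Rightarrow> (real^3 \<Rightarrow> real) \<Rightarrow> nat \<Rightarrow> (nat \<Rightarrow> real^3) \<Rightarrow> (nat \<Rightarrow> real) \<Rightarrow> real
     \<Rightarrow> (nat \<Rightarrow> real) set" where
  "admissible \<kappa> \<Omega> g N m f \<delta> =
     {b \<in> {1..N} \<rightarrow>\<^sub>E {0<..}. b 1 = 1 \<and> (\<forall>i\<in>{2..N}. G_poly \<kappa> \<Omega> g N m b i \<le> f i + \<delta>)}"

(* scheme_step ... j b b': b' may follow b when coordinate j is treated. *)
definition scheme_step ::
  "real \<Rightarrow> (real^3) set \<Rightarrow> (real^3 \<Rightarrow> real) \<Rightarrow> nat \<Rightarrow> (nat \<Rightarrow> real^3) \<Rightarrow> (nat \<Rightarrow> real) \<Rightarrow> real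
     \<Rightarrow> nat \<Rightarrow> (nat \<Rightarrow> real) \<Rightarrow> (nat \<Rightarrow> real) \<Rightarrow> bool" where
  "scheme_step \<kappa> \<Omega> g N m f \<delta> j b b' \<longleftrightarrow>
     (if f j - \<delta> \<le> G_poly \<kappa> \<Omega> g N m b j \<and> G_poly \<kappa> \<Omega> g N m b j \<le> f j + \<delta>
      then b' = b
      else \<exists>c. 0 < c \<and> c < b j \<and> b' = b(j := c) \<and>
             f j \<le> G_poly \<kappa> \<Omega> g N m b' j \<and> G_poly \<kappa> \<Omega> g N m b' j \<le> f j + \<delta>)"

(* scheme_reach ... b0 n j b: some finite run of the scheme from b0 has b as j-th vector of
   group n. *)
inductive scheme_reach ::
  "real \<Rightarrow> (real^3) set \<Rightarrow> (real^3 \<Rightarrow> real) \<Rightarrow> nat \<Rightarrow> (nat \<Rightarrow> real^3) \<Rightarrow> (nat \<Rightarrow> real) \<Rightarrow> real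
     \<Rightarrow> (nat \<Rightarrow> real) \<Rightarrow> nat \<Rightarrow> nat \<Rightarrow> (nat \<Rightarrow> real) \<Rightarrow> bool"
  for \<kappa> \<Omega> g N m f \<delta> b0 where
  start: "scheme_reach \<kappa> \<Omega> g N m f \<delta> b0 1 1 b0"
| step: "scheme_reach \<kappa> \<Omega> g N m f \<delta> b0 n (Suc j) b'"
    if "scheme_reach \<kappa> \<Omega> g N m f \<delta> b0 n j b" "j < N" "scheme_step \<kappa> \<Omega> g N m f \<delta> (Suc j) b b'"
| next_group: "scheme_reach \<kappa> \<Omega> g N m f \<delta> b0 (Suc n) 1 b"
    if "scheme_reach \<kappa> \<Omega> g N m f \<delta> b0 n N b"

(* Infinite runs; B n j is the j-th vector of group n, meaningful for n \<ge> 1 and j in {1..N}. *)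
definition scheme_seq ::
  "real \<Rightarrow> (real^3) set \<Rightarrow> (real^3 \<Rightarrow> real) \<Rightarrow> nat \<Rightarrow> (nat \<Rightarrow> real^3) \<Rightarrow> (nat \<Rightarrow> real) \<Rightarrow> real
     \<Rightarrow> (nat \<Rightarrow> real) \<Rightarrow> (nat \<Rightarrow> nat \<Rightarrow> (nat \<Rightarrow> real)) \<Rightarrow> bool" where
  "scheme_seq \<kappa> \<Omega> g N m f \<delta> b0 B \<longleftrightarrow>
     B 1 1 = b0 \<and>
     (\<forall>n\<ge>1. B (n + 1) 1 = B n N) \<and>
     (\<forall>n\<ge>1. \<forall>j\<in>{2..N}. scheme_step \<kappa> \<Omega> g N m f \<delta> j (B n (j - 1)) (B n j))"

definition angle_table :: "nat \<Rightarrow> (nat \<Rightarrow> real^3) \<Rightarrow> nat \<Rightarrow> nat \<Rightarrow> real" where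
  "angle_table N m = (\<lambda>i\<in>{1..N}. \<lambda>j\<in>{1..N}. arccos (m i \<bullet> m j))"

end

theory Submission
  imports Defs
begin

text \<open>
  Let \<open>\<nu>\<close> be the measure with density \<open>g\<close>. Up to null sets, \<open>G\<^sub>i(b)\<close> is the \<open>\<nu>\<close>-measure of the
  face on which the \<open>i\<close>-th ellipsoid realizes the minimum. Lowering \<open>b\<^sub>j\<close> to \<open>c\<close> enlarges the \<open>j\<close>-th
  face only inside the strips \<open>c / b\<^sub>k \<le> (1 - \<kappa> m\<^sub>j \<bullet> x) / (1 - \<kappa> m\<^sub>k \<bullet> x) \<le> b\<^sub>j / b\<^sub>k\<close>, and shrinks the other
  faces. The key point is that a strip has area \<open>O(\<beta> - \<alpha>)\<close>, with \<open>\<alpha>, \<beta>\<close> the bounds on the ratio: on the convex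
  cone where \<open>m\<^sub>j \<bullet> x \<ge> \<kappa> \<bar>x\<bar>\<close> and \<open>m\<^sub>k \<bullet> x \<ge> \<kappa> \<bar>x\<bar>\<close> the ratio increases in the fixed direction \<open>m\<^sub>k - m\<^sub>j\<close>
  with speed at least \<open>\<kappa>\<^sup>3 (1 - m\<^sub>j \<bullet> m\<^sub>k)\<^sup>2\<close>, so suitable translates of the strip are disjoint and
  their number bounds its volume. Hence \<open>G\<^sub>j\<close> is Lipschitz in \<open>b\<^sub>j\<close>: the intermediate value theorem
  gives the steps, and each proper step, which raises \<open>G\<^sub>j\<close> by more than \<open>\<delta>\<close>, lowers the sum of the
  coordinates by a fixed amount, while every coordinate of an admissible vector is at least
  \<open>1 / (1 + \<kappa>)\<close>.
\<close>

section \<open>Area of strips between two ellipsoids\<close>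

text \<open>This is Bessel's inequality for the orthogonal vectors \<open>c - a\<close> and
  \<open>a + c\<close>, whose squared norms are \<open>2 * (1 - a \<bullet> c)\<close> and
  \<open>2 * (1 + a \<bullet> c)\<close>. Denominators are cleared, so that it also covers
  \<open>c = a\<close> and \<open>c = - a\<close>.\<close>

lemma bessel_two_unit_vectors:
  fixes a c x :: "'a::real_inner"
  assumes "norm a = 1" "norm c = 1"
  shows "(c \<bullet> x - a \<bullet> x)\<^sup>2 * (1 + a \<bullet> c) + (a \<bullet> x + c \<bullet> x)\<^sup>2 * (1 - a \<bullet> c)
    \<le> 2 * (1 - (a \<bullet> c)\<^sup>2) * (norm x)\<^sup>2"
proof -
  define g where "g = a \<bullet> c"
  have aa: "a \<bullet> a = 1" "c \<bullet> c = 1" "c \<bullet> a = g"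
    using assms by (auto simp: norm_eq_1 g_def inner_commute)
  have "\<bar>g\<bar> \<le> 1"
    using Cauchy_Schwarz_ineq2[of a c] assms by (simp add: g_def)
  show ?thesis
  proof (cases "1 - g\<^sup>2 = 0")
    case True
    then have "g = 1 \<or> g = -1"
      by (simp add: power2_eq_1_iff)
    then show ?thesis
    proof
      assume "g = 1"
      then have "(a - c) \<bullet> (a - c) = 0"
        by (simp add: aa inner_diff g_def[symmetric])
      then have "c = a" by simp
      then show ?thesis using aa(1) by simp
    next
      assume "g = -1"
      then have "(a + c) \<bullet> (a + c) = 0"
        by (simp add: aa inner_add g_def[symmetric])
      then have "c = - a" by (simp add: eq_neg_iff_add_eq_0 add.commute)
      then show ?thesis using aa(1) by simp
    qed
  next
    case False
    define p q where "p = a \<bullet> x" and "q = c \<bullet> x"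
    have expand: "(u *\<^sub>R x - v *\<^sub>R a - w *\<^sub>R c) \<bullet> (u *\<^sub>R x - v *\<^sub>R a - w *\<^sub>R c)
      = u\<^sup>2 * (x \<bullet> x) + v\<^sup>2 + w\<^sup>2 - 2 * u * v * p - 2 * u * w * q + 2 * v * w * g" for u v w
    proof -
      have comm: "x \<bullet> a = p" "x \<bullet> c = q" "a \<bullet> x = p" "c \<bullet> x = q" "a \<bullet> c = g"
        by (simp_all add: p_def q_def g_def inner_commute)
      show ?thesis
        by (simp only: inner_diff_left inner_diff_right inner_scaleR_left inner_scaleR_right comm aa)
          (simp add: power2_eq_square algebra_simps)
    qed
    \<comment> \<open>The vector is \<open>1 - g\<^sup>2\<close> times the component of
      \<open>x\<close> orthogonal to the span of \<open>a\<close> and \<open>c\<close>.\<close>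
    have "0 \<le> ((1 - g\<^sup>2) *\<^sub>R x - (p - g * q) *\<^sub>R a - (q - g * p) *\<^sub>R c)
        \<bullet> ((1 - g\<^sup>2) *\<^sub>R x - (p - g * q) *\<^sub>R a - (q - g * p) *\<^sub>R c)" by (rule inner_ge_zero)
    also have "\<dots> = (1 - g\<^sup>2) * ((1 - g\<^sup>2) * (x \<bullet> x) - (p\<^sup>2 + q\<^sup>2 - 2 * g * p * q))"
      unfolding expand by (simp add: power2_eq_square algebra_simps)
    finally have "0 \<le> (1 - g\<^sup>2) * ((1 - g\<^sup>2) * (x \<bullet> x) - (p\<^sup>2 + q\<^sup>2 - 2 * g * p * q))" .
    moreover have "1 - g\<^sup>2 > 0"
      using False \<open>\<bar>g\<bar> \<le> 1\<close> abs_square_le_1[of g] by linarith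
    ultimately have "p\<^sup>2 + q\<^sup>2 - 2 * g * p * q \<le> (1 - g\<^sup>2) * (x \<bullet> x)"
      by (simp add: zero_le_mult_iff)
    then have "2 * (p\<^sup>2 + q\<^sup>2 - 2 * g * p * q) \<le> 2 * ((1 - g\<^sup>2) * (x \<bullet> x))" by simp
    moreover have "(q - p)\<^sup>2 * (1 + g) + (p + q)\<^sup>2 * (1 - g) = 2 * (p\<^sup>2 + q\<^sup>2 - 2 * g * p * q)"
      by (simp add: power2_eq_square algebra_simps)
    ultimately have "(q - p)\<^sup>2 * (1 + g) + (p + q)\<^sup>2 * (1 - g) \<le> 2 * (1 - g\<^sup>2) * (x \<bullet> x)"
      by (simp only: mult.assoc)
    then show ?thesis unfolding power2_norm_eq_inner g_def p_def q_def .
  qed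
qed

text \<open>Up to a positive factor, the right-hand side is the numerator of the increment in
  \<open>ratio_increment\<close>. The hypotheses on \<open>S\<close> and \<open>U\<close> are Bessel
  bounds; multiplied together they control \<open>S * U\<close>, and the positive lower bound
  \<open>k\<close> leaves a gain.\<close>

lemma one_minus_product_bound:
  fixes S U w k g :: real
  assumes g: "-1 < g" "g \<le> 1" and k: "0 < k" "k \<le> w"
    and S: "S\<^sup>2 * (1 + g) + 4 * w\<^sup>2 * (1 - g) \<le> 2 * (1 - g\<^sup>2)"
    and U: "U\<^sup>2 * (1 + g) + 4 * k\<^sup>2 * (1 - g) \<le> 2 * (1 - g\<^sup>2)"
  shows "(1 - g)\<^sup>2 * k\<^sup>2 \<le> 2 * (1 - g) * (1 - k * w) - S * U"
proof (cases "g = 1")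
  case True
  then have "S = 0" using S by simp
  then show ?thesis using True by simp
next
  case False
  define X where "X = 2 * (1 + g) - 4 * w\<^sup>2"
  define Y where "Y = 2 * (1 + g) - 4 * k\<^sup>2"
  define Z where "Z = 2 * (1 + g) - 4 * (w * k)"
  have S': "S\<^sup>2 * (1 + g) \<le> (1 - g) * X" and U': "U\<^sup>2 * (1 + g) \<le> (1 - g) * Y"
    using S U by (simp_all add: X_def Y_def power2_eq_square algebra_simps)
  have "0 \<le> (1 - g) * X" by (rule order_trans[OF _ S']) (use g in simp)
  then have X: "0 \<le> X" using g False by (simp add: zero_le_mult_iff)
  have "w * k \<le> w * w" using k by (intro mult_left_mono) auto
  then have Z: "0 \<le> Z" using X by (simp add: X_def Z_def power2_eq_square)
  \<comment> \<open>\<open>Z\<close> is the polarized form belonging to \<open>X\<close> and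
    \<open>Y\<close>; the form is indefinite, which reverses the Cauchy-Schwarz inequality.\<close>
  have "X * Y \<le> Z\<^sup>2"
  proof -
    have "Z\<^sup>2 - X * Y = 8 * (1 + g) * (w - k)\<^sup>2"
      by (simp add: X_def Y_def Z_def power2_eq_square algebra_simps)
    also have "\<dots> \<ge> 0" using g by simp
    finally show ?thesis by simp
  qed
  have "(S * U * (1 + g))\<^sup>2 = (S\<^sup>2 * (1 + g)) * (U\<^sup>2 * (1 + g))"
    by (simp add: power2_eq_square algebra_simps)
  also have "\<dots> \<le> ((1 - g) * X) * ((1 - g) * Y)"
    using g by (intro mult_mono[OF S' U'] \<open>0 \<le> (1 - g) * X\<close>) auto
  also have "\<dots> = (1 - g)\<^sup>2 * (X * Y)" by (simp add: power2_eq_square)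
  also have "\<dots> \<le> (1 - g)\<^sup>2 * Z\<^sup>2" using \<open>X * Y \<le> Z\<^sup>2\<close> by (intro mult_left_mono) auto
  also have "\<dots> = ((1 - g) * Z)\<^sup>2" by (simp add: power_mult_distrib)
  finally have "S * U * (1 + g) \<le> (1 - g) * Z"
    by (rule power2_le_imp_le) (use g Z in simp)
  then have "2 * (1 - g)\<^sup>2 * (k * w) \<le> (1 + g) * (2 * (1 - g) * (1 - k * w) - S * U)"
    by (simp add: Z_def power2_eq_square algebra_simps)
  \<comment> \<open>This uses \<open>1 + g \<le> 2\<close> and \<open>k \<le> w\<close>.\<close>
  moreover have "(1 + g) * ((1 - g)\<^sup>2 * k\<^sup>2) \<le> 2 * ((1 - g)\<^sup>2 * (k * w))"
    using g k by (intro mult_mono) (auto simp: power2_eq_square)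
  ultimately have "(1 + g) * ((1 - g)\<^sup>2 * k\<^sup>2) \<le> (1 + g) * (2 * (1 - g) * (1 - k * w) - S * U)"
    by linarith
  then show ?thesis using g by simp
qed

text \<open>Cross-multiplying the two fractions turns the increment into
  \<open>s * \<kappa> * r\<close> times the quantity bounded in
  \<open>one_minus_product_bound\<close>. There \<open>w\<close> is the mean and \<open>S\<close>
  the difference of the cosines of the angles between \<open>y\<close> and the two directions, while
  \<open>U\<close> is the difference quotient of the norm: \<open>r' - r = s * U\<close>.\<close>

lemma ratio_increment:
  fixes a c y y' :: "'a::real_inner" and \<kappa> s :: real
  assumes unit: "norm a = 1" "norm c = 1" and \<kappa>: "0 < \<kappa>" "\<kappa> < 1" and s: "0 < s"
    and y': "y' = y + s *\<^sub>R (c - a)" and nz: "y \<noteq> 0" "y' \<noteq> 0" and le1: "norm y' \<le> 1"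
    and D: "\<kappa> * norm y \<le> a \<bullet> y" "\<kappa> * norm y \<le> c \<bullet> y"
           "\<kappa> * norm y' \<le> a \<bullet> y'" "\<kappa> * norm y' \<le> c \<bullet> y'"
  shows "(norm y - \<kappa> * (a \<bullet> y)) / (norm y - \<kappa> * (c \<bullet> y)) + \<kappa>^3 * (1 - a \<bullet> c)\<^sup>2 * s
    \<le> (norm y' - \<kappa> * (a \<bullet> y')) / (norm y' - \<kappa> * (c \<bullet> y'))"
proof -
  define g r r' p q p' q' where defs: "g = a \<bullet> c" "r = norm y" "r' = norm y'"
    "p = a \<bullet> y" "q = c \<bullet> y" "p' = a \<bullet> y'" "q' = c \<bullet> y'"
  have aa: "a \<bullet> a = 1" "c \<bullet> c = 1" "c \<bullet> a = g"
    using unit by (auto simp: norm_eq_1 defs inner_commute)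
  have r: "0 < r" "0 < r'" using nz by (auto simp: defs)
  have pq': "p' = p - s * (1 - g)" "q' = q + s * (1 - g)"
    using aa by (auto simp: defs y' inner_diff inner_add algebra_simps)
  have pq: "p \<le> r" "q \<le> r" "p' \<le> r'" "q' \<le> r'" "g \<le> 1" "-1 \<le> g"
    using norm_cauchy_schwarz[of a y] norm_cauchy_schwarz[of c y] norm_cauchy_schwarz[of a y']
      norm_cauchy_schwarz[of c y'] norm_cauchy_schwarz[of a c] norm_cauchy_schwarz[of "-a" c] unit
    by (auto simp: defs)
  have D': "\<kappa> * r \<le> p" "\<kappa> * r \<le> q" "\<kappa> * r' \<le> p'" "\<kappa> * r' \<le> q'"
    using D by (auto simp: defs)
  \<comment> \<open>For \<open>g = -1\<close> the directions are opposite, and \<open>p\<close> and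
    \<open>q\<close> could not both be positive.\<close>
  have g: "-1 < g"
  proof (rule ccontr)
    assume "\<not> -1 < g"
    then have "(a + c) \<bullet> (a + c) = 0"
      using pq aa by (simp add: inner_add defs)
    then have "p + q = 0" by (simp add: defs inner_add_left[symmetric])
    moreover have "0 < \<kappa> * r" using \<kappa> r by simp
    ultimately show False using D' by linarith
  qed
  have \<kappa>r: "0 < r - \<kappa> * q" "0 < r' - \<kappa> * q'" "0 \<le> \<kappa> * q" "0 \<le> \<kappa> * q'"
  proof -
    have nn: "0 \<le> q" "0 \<le> q'" using D' \<kappa> r by (meson mult_nonneg_nonneg less_imp_le order_trans)+
    show "0 \<le> \<kappa> * q" "0 \<le> \<kappa> * q'" using nn \<kappa> by auto
    have "\<kappa> * q \<le> \<kappa> * r" "\<kappa> * q' \<le> \<kappa> * r'" using pq \<kappa> by auto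
    moreover have "\<kappa> * r < r" "\<kappa> * r' < r'" using \<kappa> r by auto
    ultimately show "0 < r - \<kappa> * q" "0 < r' - \<kappa> * q'" by linarith+
  qed
  define w S U where wSU: "w = (p + q) / (2 * r)" "S = (q - p) / r" "U = (q + q' - p - p') / (r + r')"
  have rr': "r' - r = s * U"
  proof -
    have exp: "(y + s *\<^sub>R e) \<bullet> (y + s *\<^sub>R e) = y \<bullet> y + 2 * s * (e \<bullet> y) + s\<^sup>2 * (e \<bullet> e)" for e
      by (simp add: inner_add_left inner_add_right inner_commute[of y e] power2_eq_square distrib_left)
    have "(c - a) \<bullet> (c - a) = 2 * (1 - g)"
      using aa by (simp add: inner_diff_left inner_diff_right defs(1))
    moreover have "(c - a) \<bullet> y = q - p" by (simp add: defs inner_diff_left)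
    ultimately have "r'\<^sup>2 = r\<^sup>2 + 2 * s * (q - p) + s\<^sup>2 * (2 * (1 - g))"
      using exp[of "c - a"] by (simp add: defs(2,3) power2_norm_eq_inner y')
    then have "(r' - r) * (r' + r) = s * (q + q' - p - p')"
      by (simp add: pq' power2_eq_square algebra_simps)
    then show ?thesis using r by (simp add: wSU field_simps)
  qed
  have w: "\<kappa> \<le> w" using D' r by (simp add: wSU field_simps)
  have S: "S\<^sup>2 * (1 + g) + 4 * w\<^sup>2 * (1 - g) \<le> 2 * (1 - g\<^sup>2)"
  proof -
    have "(q - p)\<^sup>2 * (1 + g) + (p + q)\<^sup>2 * (1 - g) \<le> 2 * (1 - g\<^sup>2) * r\<^sup>2"
      using bessel_two_unit_vectors[OF unit, of y] by (simp add: defs)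
    moreover have "q - p = S * r" "p + q = 2 * w * r" using r by (auto simp: wSU)
    ultimately have "(S\<^sup>2 * (1 + g) + 4 * w\<^sup>2 * (1 - g)) * r\<^sup>2 \<le> 2 * (1 - g\<^sup>2) * r\<^sup>2"
      by (simp add: power_mult_distrib algebra_simps)
    then show ?thesis using r by simp
  qed
  \<comment> \<open>Bessel's inequality is applied to \<open>y + y'\<close>, whose norm is at most
    \<open>r + r'\<close>.\<close>
  have U: "U\<^sup>2 * (1 + g) + 4 * \<kappa>\<^sup>2 * (1 - g) \<le> 2 * (1 - g\<^sup>2)"
  proof -
    define R where "R = r + r'"
    have R: "0 < R" using r by (simp add: R_def)
    have 1: "norm (y + y') \<le> R" using norm_triangle_ineq[of y y'] by (simp add: R_def defs)
    have "(q + q' - p - p')\<^sup>2 * (1 + g) + (p + p' + q + q')\<^sup>2 * (1 - g)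
        \<le> 2 * (1 - g\<^sup>2) * (norm (y + y'))\<^sup>2"
      using bessel_two_unit_vectors[OF unit, of "y + y'"] by (simp add: defs inner_add algebra_simps)
    also have "\<dots> \<le> 2 * (1 - g\<^sup>2) * R\<^sup>2"
      using pq 1 by (intro mult_left_mono power_mono) (auto simp: abs_square_le_1 abs_le_iff)
    finally have 2: "(q + q' - p - p')\<^sup>2 * (1 + g) + (p + p' + q + q')\<^sup>2 * (1 - g) \<le> 2 * (1 - g\<^sup>2) * R\<^sup>2" .
    have "2 * \<kappa> * R \<le> p + p' + q + q'" using D' by (simp add: R_def algebra_simps)
    then have "(2 * \<kappa> * R)\<^sup>2 \<le> (p + p' + q + q')\<^sup>2" using \<kappa> R by (intro power_mono) auto
    then have "(2 * \<kappa> * R)\<^sup>2 * (1 - g) \<le> (p + p' + q + q')\<^sup>2 * (1 - g)"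
      using pq by (intro mult_right_mono) auto
    with 2 have "(q + q' - p - p')\<^sup>2 * (1 + g) + (2 * \<kappa> * R)\<^sup>2 * (1 - g) \<le> 2 * (1 - g\<^sup>2) * R\<^sup>2"
      by linarith
    moreover have "q + q' - p - p' = U * R" using R by (simp add: wSU R_def)
    ultimately have "(U\<^sup>2 * (1 + g) + 4 * \<kappa>\<^sup>2 * (1 - g)) * R\<^sup>2 \<le> 2 * (1 - g\<^sup>2) * R\<^sup>2"
      by (simp add: power_mult_distrib algebra_simps)
    then show ?thesis using R by simp
  qed
  define n n' h where nn: "n = r - \<kappa> * q" "n' = r' - \<kappa> * q'" "h = (r - \<kappa> * p) / n"
  have n: "0 < n" "n \<le> r" "0 < n'" "n' \<le> 1" using \<kappa>r le1 by (auto simp: nn defs)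
  \<comment> \<open>\<open>F\<close> is \<open>n'\<close> times the growth of the ratio. As
    \<open>n' \<le> 1\<close>, a nonnegative lower bound for \<open>F\<close> is one for the growth
    itself.\<close>
  define F where "F = r' - \<kappa> * p' - h * n'"
  have hn: "h * n = r - \<kappa> * p" using n by (simp add: nn(3))
  have "F * n = (r' - \<kappa> * p') * n - (r - \<kappa> * p) * n'"
    by (simp add: F_def algebra_simps hn[symmetric])
  also have "\<dots> = s * \<kappa> * r * (2 * (1 - g) * (1 - \<kappa> * w) - S * U)"
  proof -
    have e: "r' = r + s * U" using rr' by simp
    have wr: "2 * w * r = p + q" "S * r = q - p" using r by (auto simp: wSU)
    have "r * (2 * (1 - g) * (1 - \<kappa> * w) - S * U) = (1 - g) * (2 * r - \<kappa> * (2 * w * r)) - (S * r) * U"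
      by (simp add: algebra_simps)
    then have 3: "r * (2 * (1 - g) * (1 - \<kappa> * w) - S * U) = (1 - g) * (2 * r - \<kappa> * (p + q)) - (q - p) * U"
      unfolding wr .
    have "s * \<kappa> * r * (2 * (1 - g) * (1 - \<kappa> * w) - S * U)
        = s * \<kappa> * ((1 - g) * (2 * r - \<kappa> * (p + q)) - (q - p) * U)"
      using 3 by (simp only: mult.assoc)
    then show ?thesis unfolding nn e pq' by (simp add: algebra_simps)
  qed
  also have "\<dots> \<ge> s * \<kappa> * r * ((1 - g)\<^sup>2 * \<kappa>\<^sup>2)"
    using one_minus_product_bound[OF g pq(5) \<kappa>(1) w S U] s \<kappa> r by (intro mult_left_mono) auto
  also have "s * \<kappa> * r * ((1 - g)\<^sup>2 * \<kappa>\<^sup>2) \<ge> s * \<kappa> * n * ((1 - g)\<^sup>2 * \<kappa>\<^sup>2)"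
    using s \<kappa> n by (intro mult_right_mono mult_left_mono) auto
  finally have "(\<kappa>^3 * (1 - g)\<^sup>2 * s) * n \<le> F * n"
    by (simp add: power2_eq_square power3_eq_cube algebra_simps)
  then have F: "\<kappa>^3 * (1 - g)\<^sup>2 * s \<le> F" using n by simp
  moreover have "0 \<le> \<kappa>^3 * (1 - g)\<^sup>2 * s" using \<kappa> s by simp
  ultimately have "F * n' \<le> F" using n by (intro mult_left_le) auto
  then have "F \<le> F / n'" using n by (simp add: field_simps)
  moreover have "F / n' = (r' - \<kappa> * p') / n' - h" using n by (simp add: F_def diff_divide_distrib)
  ultimately have "h + \<kappa>^3 * (1 - g)\<^sup>2 * s \<le> (r' - \<kappa> * p') / n'" using F by linarith
  then show ?thesis unfolding nn defs .
qed

text \<open>The translates of \<open>A\<close> by multiples of \<open>(2 (\<beta> - \<alpha>) / c) e\<close> are disjoint, because \<open>h\<close> varies by at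
  most \<open>\<beta> - \<alpha>\<close> on \<open>A\<close>.\<close>
lemma strip_packing:
  fixes A :: "'a::euclidean_space set" and e :: 'a and h :: "'a \<Rightarrow> real"
  assumes A: "A \<in> sets borel" "A \<subseteq> cball 0 1" and e: "norm e \<le> 2"
    and c: "0 < c" and ab: "\<alpha> < \<beta>" and h: "\<And>x. x \<in> A \<Longrightarrow> h x \<in> {\<alpha>..\<beta>}"
    and incr: "\<And>x s. x \<in> A \<Longrightarrow> x + s *\<^sub>R e \<in> A \<Longrightarrow> 0 < s \<Longrightarrow> h x + c * s \<le> h (x + s *\<^sub>R e)"
  shows "measure lborel A \<le> 2 * measure lborel (cball (0::'a) 3) * (\<beta> - \<alpha>) / c"
proof -
  \<comment> \<open>Over one spacing \<open>s0\<close> the function \<open>h\<close> would rise by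
    twice the width of the interval containing its values on \<open>A\<close>, which excludes
    overlaps.\<close>
  define s0 where "s0 = 2 * (\<beta> - \<alpha>) / c"
  have s0: "0 < s0" "c * s0 = 2 * (\<beta> - \<alpha>)" using c ab by (auto simp: s0_def)
  \<comment> \<open>This many translates suffice for the volume bound, while the shift parameters
    \<open>k * s0\<close> with \<open>k < n\<close> are at most 1, so that all translates fit into
    the ball of radius \<open>1 + 2 = 3\<close>.\<close>
  define n where "n = nat \<lceil>1 / s0\<rceil>"
  have n: "1 / s0 \<le> real n" "0 < n"
    using s0 by (auto simp: n_def real_nat_ceiling_ge)
  have n1: "real k * s0 \<le> 1" if "k < n" for k
  proof -
    have "real k < 1 / s0" using that unfolding n_def by linarith
    then show ?thesis using s0 by (simp add: field_simps)
  qed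
  define T where "T k = (+) ((real k * s0) *\<^sub>R e) ` A" for k :: nat
  have mT: "T k \<in> sets lborel" "measure lborel (T k) = measure lborel A" for k
  proof -
    have "T k = (\<lambda>x. x - (real k * s0) *\<^sub>R e) -` A"
      by (force simp: T_def image_iff)
    moreover have "(\<lambda>x. x - (real k * s0) *\<^sub>R e) -` A \<inter> space borel \<in> sets borel"
      using A by (intro measurable_sets[where A=borel]) auto
    ultimately show "T k \<in> sets lborel" by simp
    then have "measure lborel (T k) = measure lebesgue (T k)"
      by (simp add: measure_completion)
    also have "\<dots> = measure lebesgue A" unfolding T_def by (rule measure_translation)
    also have "\<dots> = measure lborel A" using A by (simp add: measure_completion)
    finally show "measure lborel (T k) = measure lborel A" .
  qed
  have disj: "disjoint_family_on T {..<n}"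
    unfolding disjoint_family_on_def
  proof (intro ballI impI)
    fix k l :: nat
    assume "k \<noteq> l"
    show "T k \<inter> T l = {}"
      using \<open>k \<noteq> l\<close>
    proof (induction k l rule: linorder_wlog)
      case (le k l)
      show ?case
      proof (rule ccontr)
        assume "T k \<inter> T l \<noteq> {}"
        then obtain x y where xy: "x \<in> A" "y \<in> A"
          "(real k * s0) *\<^sub>R e + x = (real l * s0) *\<^sub>R e + y" by (auto simp: T_def)
        have kl: "1 \<le> real l - real k" using le by linarith
        have x: "x = y + ((real l - real k) * s0) *\<^sub>R e"
          using xy(3) by (simp add: algebra_simps)
        have "h y + c * ((real l - real k) * s0) \<le> h x"
          unfolding x using xy kl s0 x by (intro incr) auto
        moreover have "c * s0 \<le> c * ((real l - real k) * s0)"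
          using c s0(1) kl by simp
        ultimately have "h y + c * s0 \<le> h x" by linarith
        moreover have "\<alpha> \<le> h y" "h x \<le> \<beta>" using h xy by force+
        ultimately have "c * s0 \<le> \<beta> - \<alpha>" by simp
        then show False using s0(2) ab by simp
      qed
    qed auto
  qed
  have T3: "T k \<subseteq> cball 0 3" if "k < n" for k
  proof
    fix z assume "z \<in> T k"
    then obtain x where x: "x \<in> A" "z = (real k * s0) *\<^sub>R e + x" by (auto simp: T_def)
    have "norm z \<le> (real k * s0) * norm e + norm x"
      using norm_triangle_ineq[of "(real k * s0) *\<^sub>R e" x] s0 x by simp
    also have "\<dots> \<le> 1 * 2 + 1"
      using n1[OF that] e s0 x A by (intro add_mono mult_mono) auto
    finally show "z \<in> cball 0 3" by simp
  qed
  have fin: "emeasure lborel (T k) \<noteq> \<infinity>" if "k < n" for k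
    using emeasure_mono[OF T3[OF that], of lborel] emeasure_lborel_cball_finite[of "0::'a" 3]
    by (auto simp: top_unique)
  have "real n * measure lborel A = (\<Sum>k<n. measure lborel (T k))" by (simp add: mT)
  also have "\<dots> = measure lborel (\<Union>k<n. T k)"
    by (rule measure_finite_Union[symmetric]) (use disj mT fin in auto)
  also have "\<dots> \<le> measure lborel (cball (0::'a) 3)"
    using mT T3 emeasure_lborel_cball_finite[of "0::'a" 3]
    by (intro measure_mono_fmeasurable) (auto simp: fmeasurable_def)
  finally have "real n * measure lborel A \<le> measure lborel (cball (0::'a) 3)" .
  moreover have "1 / s0 * measure lborel A \<le> real n * measure lborel A"
    using n by (intro mult_right_mono) auto
  ultimately have "1 / s0 * measure lborel A \<le> measure lborel (cball (0::'a) 3)" by linarith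
  then have "measure lborel A \<le> s0 * measure lborel (cball (0::'a) 3)"
    using s0 by (simp add: field_simps)
  then show ?thesis unfolding s0_def by (simp only: times_divide_eq_left times_divide_eq_right mult_ac)
qed

text \<open>The area of \<open>A\<close> is three times the volume of the cone \<open>B\<close> over
  \<open>A\<close> in the unit ball. The ratio extends to the cone as a function \<open>h\<close>
  homogeneous of degree 0, to which \<open>ratio_increment\<close> and \<open>strip_packing\<close>
  apply.\<close>

lemma measure_sphere_strip_le:
  fixes a c :: "real^3" and A :: "(real^3) set"
  assumes unit: "norm a = 1" "norm c = 1" and \<kappa>: "0 < \<kappa>" "\<kappa> < 1" and ac: "a \<noteq> c"
    and A: "A \<in> sets borel" "A \<subseteq> S2"
    and D: "\<And>x. x \<in> A \<Longrightarrow> \<kappa> \<le> a \<bullet> x" "\<And>x. x \<in> A \<Longrightarrow> \<kappa> \<le> c \<bullet> x"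
    and ab: "\<alpha> < \<beta>"
    and strip: "\<And>x. x \<in> A \<Longrightarrow> (1 - \<kappa> * (a \<bullet> x)) / (1 - \<kappa> * (c \<bullet> x)) \<in> {\<alpha>..\<beta>}"
  shows "measure sphere_measure A \<le> 216 * pi / (\<kappa>^3 * (1 - a \<bullet> c)\<^sup>2) * (\<beta> - \<alpha>)"
proof -
  define B where "B = {y \<in> cball 0 1 - {0}. sgn y \<in> A}"
  define h where "h y = (norm y - \<kappa> * (a \<bullet> y)) / (norm y - \<kappa> * (c \<bullet> y))" for y :: "real^3"
  have ac1: "a \<bullet> c \<noteq> 1"
  proof
    assume "a \<bullet> c = 1"
    then have "(a - c) \<bullet> (a - c) = 0"
      using unit by (simp add: norm_eq_1 inner_diff inner_commute)
    with ac show False by simp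
  qed
  have "(\<lambda>y. y /\<^sub>R norm y) \<in> borel \<rightarrow>\<^sub>M (borel :: (real^3) measure)" by measurable
  then have "sgn -` A \<inter> space borel \<in> sets (borel :: (real^3) measure)"
    using A(1) unfolding sgn_div_norm[abs_def, symmetric] by (rule measurable_sets)
  moreover have "B = (cball 0 1 - {0}) \<inter> sgn -` A" by (auto simp: B_def)
  ultimately have B: "B \<in> sets borel" by auto
  have sgnB: "norm y * (a \<bullet> sgn y) = a \<bullet> y" "norm y * (c \<bullet> sgn y) = c \<bullet> y" "0 < norm y" if "y \<in> B" for y
    using that by (auto simp: B_def sgn_div_norm)
  have DB: "\<kappa> * norm y \<le> a \<bullet> y" "\<kappa> * norm y \<le> c \<bullet> y" if "y \<in> B" for y
    using D[of "sgn y"] that sgnB[OF that]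
    by (metis (no_types, lifting) B_def mem_Collect_eq mult.commute mult_left_mono less_imp_le)+
  have hB: "h y \<in> {\<alpha>..\<beta>}" if y: "y \<in> B" for y
  proof -
    have "h y = (norm y * (1 - \<kappa> * (a \<bullet> sgn y))) / (norm y * (1 - \<kappa> * (c \<bullet> sgn y)))"
      using sgnB[OF y] by (simp add: h_def right_diff_distrib mult.left_commute[of "norm y"])
    also have "\<dots> = (1 - \<kappa> * (a \<bullet> sgn y)) / (1 - \<kappa> * (c \<bullet> sgn y))" using sgnB(3)[OF y] by simp
    finally show ?thesis using strip[of "sgn y"] y by (simp add: B_def)
  qed
  have "measure lborel B \<le> 2 * measure lborel (cball (0::real^3) 3) * (\<beta> - \<alpha>) / (\<kappa>^3 * (1 - a \<bullet> c)\<^sup>2)"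
  proof (rule strip_packing[where e = "c - a" and h = h])
    show "norm (c - a) \<le> 2" using norm_triangle_ineq4[of c a] unit by simp
    show "h y + \<kappa>^3 * (1 - a \<bullet> c)\<^sup>2 * s \<le> h (y + s *\<^sub>R (c - a))"
      if "y \<in> B" "y + s *\<^sub>R (c - a) \<in> B" "0 < s" for y s
      using ratio_increment[OF unit \<kappa> that(3) refl, of y] DB[OF that(1)] DB[OF that(2)] that
      unfolding h_def by (simp add: B_def)
  qed (use B hB \<kappa> ac1 ab in \<open>auto simp: B_def\<close>)
  \<comment> \<open>The ball of radius 3 has volume \<open>36 * pi\<close>, and
    \<open>3 * 2 * 36 = 216\<close>.\<close>
  moreover have "measure lborel (cball (0::real^3) 3) = 36 * pi"
    by (simp add: measure_def emeasure_cball eval_unit_ball_vol)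
  moreover have "measure sphere_measure A = 3 * measure lborel B"
    using emeasure_sphere_measure[OF A] by (simp add: measure_def B_def enn2real_mult)
  ultimately show ?thesis by simp
qed

section \<open>Faces of a polyhedral refractor\<close>

lemma sets_sphere_measure_borel: "A \<in> sets borel \<Longrightarrow> A \<subseteq> S2 \<Longrightarrow> A \<in> sets sphere_measure"
  by (simp add: sphere_measure_def sets_restrict_space_iff)

lemma finite_measure_sphere: "finite_measure sphere_measure"
  by (rule finite_measureI) (simp add: space_sphere_measure emeasure_sphere_measure_S2)

text \<open>Completeness of the surface measure yields measurability of tracing sets, which differ
  from faces by a subset of a null set.\<close>

lemma null_sets_sphere_subset:
  "A \<in> null_sets sphere_measure \<Longrightarrow> B \<subseteq> A \<Longrightarrow> B \<in> null_sets sphere_measure"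
  unfolding sphere_measure_def by (rule null_sets_completion_subset)

text \<open>The data without the targets \<open>f\<close> and the tolerance \<open>\<delta>\<close>.
  The assumption \<open>mass\<close> makes the essential supremum of \<open>g\<close>
  positive.\<close>

locale refraction =
  fixes \<kappa> :: real and \<Omega> \<Omega>' :: "(real^3) set" and g :: "real^3 \<Rightarrow> real"
    and N :: nat and m :: "nat \<Rightarrow> real^3"
  assumes \<kappa>: "0 < \<kappa>" "\<kappa> < 1"
    and domains: "refraction_domains \<kappa> \<Omega> \<Omega>'"
    and g_bounded: "ess_bounded (restrict_space sphere_measure (closure \<Omega>)) g"
    and g_nonneg: "AE x in restrict_space sphere_measure (closure \<Omega>). 0 \<le> g x"
    and N: "2 \<le> N"
    and m: "m ` {1..N} \<subseteq> closure \<Omega>'" "inj_on m {1..N}"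
    and mass: "0 < set_lebesgue_integral sphere_measure (closure \<Omega>) g"
begin

section \<open>Measurability on the domain and the essential supremum of \<open>g\<close>\<close>

abbreviation M where "M \<equiv> restrict_space sphere_measure (closure \<Omega>)"
abbreviation Gmax where "Gmax \<equiv> ess_sup_on \<Omega> g"

lemma domain_subset_S2: "\<Omega> \<subseteq> S2" "\<Omega>' \<subseteq> S2"
  using domains by (auto simp: refraction_domains_def sphere_domain_def openin_imp_subset dest: openin_imp_subset)

lemma closure_subset_S2: "closure \<Omega> \<subseteq> S2" "closure \<Omega>' \<subseteq> S2"
  using domain_subset_S2 by (simp_all add: closure_minimal)

lemma closure_sets: "closure \<Omega> \<in> sets sphere_measure" "closure \<Omega> \<inter> space sphere_measure \<in> sets sphere_measure"
  using closure_subset_S2(1) sets_sphere_measure_borel[of "closure \<Omega>"]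
  by (auto simp: space_sphere_measure Int_absorb2)

lemma domain_sets: "\<Omega> \<in> sets sphere_measure" "\<Omega> \<inter> space sphere_measure \<in> sets sphere_measure"
proof -
  obtain U where "open U" "\<Omega> = S2 \<inter> U"
    using domains by (auto simp: refraction_domains_def sphere_domain_def openin_open)
  then show "\<Omega> \<in> sets sphere_measure" by (auto intro!: sets_sphere_measure_borel)
  then show "\<Omega> \<inter> space sphere_measure \<in> sets sphere_measure"
    using domain_subset_S2 by (simp add: space_sphere_measure Int_absorb2)
qed

text \<open>The relative boundary of the domain is null. This links the closure, where
  \<open>g\<close> is assumed bounded, with the domain, where the essential supremum is
  taken.\<close>

lemma AE_closure_iff: "(AE x in M. P x) \<longleftrightarrow> (AE x in restrict_space sphere_measure \<Omega>. P x)"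
proof -
  have "closure \<Omega> - \<Omega> \<subseteq> (top_of_set S2) frontier_of \<Omega>"
    using domains closure_subset_S2(1) domain_subset_S2(1)
    by (auto simp: frontier_of_def interior_of_openin refraction_domains_def sphere_domain_def
        closure_of_subtopology Int_absorb1)
  then have "closure \<Omega> - \<Omega> \<in> null_sets sphere_measure"
    using domains null_sets_sphere_subset by (auto simp: refraction_domains_def)
  then have "AE x in sphere_measure. x \<notin> closure \<Omega> - \<Omega>" by (rule AE_not_in)
  then have *: "AE x in sphere_measure. x \<in> closure \<Omega> \<longleftrightarrow> x \<in> \<Omega>"
    by eventually_elim (use closure_subset in auto)
  show ?thesis
    unfolding AE_restrict_space_iff[OF closure_sets(2)] AE_restrict_space_iff[OF domain_sets(2)]
    by (rule eventually_subst) (use * in eventually_elim, simp)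
qed

lemma g_measurable: "g \<in> borel_measurable M"
  using g_bounded by (simp add: ess_bounded_def)

text \<open>Finiteness from above comes first, since \<open>real_of_ereal\<close> sends an infinite
  supremum to 0; it follows from the bound on \<open>\<bar>g x\<bar>\<close>. If the supremum were
  not positive, \<open>g\<close> would vanish almost everywhere, against
  \<open>mass\<close>.\<close>

lemma Gmax_bound: "AE x in M. g x \<le> Gmax" and Gmax_pos: "0 < Gmax"
proof -
  let ?R = "restrict_space sphere_measure \<Omega>"
  define s where "s = esssup ?R (\<lambda>x. ereal (g x))"
  have meas: "g \<in> borel_measurable ?R"
  proof -
    have "restrict_space M \<Omega> = ?R"
      using closure_subset[of \<Omega>] closure_sets domain_sets
      by (simp add: restrict_restrict_space Int_absorb1)
    then show ?thesis using measurable_restrict_space1[OF g_measurable, of \<Omega>] by simp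
  qed
  define t where "t = esssup M (\<lambda>x. ereal \<bar>g x\<bar>)"
  have t: "t < \<infinity>" using g_bounded by (simp add: ess_bounded_def t_def)
  have "AE x in M. ereal \<bar>g x\<bar> \<le> t" unfolding t_def by (rule esssup_AE)
  then have "AE x in M. ereal (g x) \<le> t"
    by eventually_elim (metis abs_ge_self ereal_less_eq(3) order_trans)
  then have "s \<le> t" unfolding s_def AE_closure_iff using meas by (intro esssup_I) auto
  then have s: "s < \<infinity>" using t by (rule le_less_trans)
  have AE_s: "AE x in M. ereal (g x) \<le> s" unfolding AE_closure_iff s_def by (rule esssup_AE)
  then show bound: "AE x in M. g x \<le> Gmax"
  proof eventually_elim
    case (elim x)
    then show ?case using s
      by (cases s) (auto simp: ess_sup_on_def s_def[symmetric])
  qed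
  show "0 < Gmax"
  proof (rule ccontr)
    assume neg: "\<not> 0 < Gmax"
    have "AE x in M. g x = 0" using bound g_nonneg by eventually_elim (use neg in linarith)
    then have "(\<integral>x. g x \<partial>M) = (\<integral>x. 0 \<partial>M)"
      using g_measurable by (intro integral_cong_AE) auto
    then have "(\<integral>x. g x \<partial>M) = 0" by simp
    then show False
      using mass by (simp add: integral_restrict_space[OF closure_sets(2)] set_lebesgue_integral_def)
  qed
qed

section \<open>The finite measure with density \<open>g\<close>\<close>

definition \<nu> where "\<nu> = density M (\<lambda>x. ennreal (g x))"

lemma sets_\<nu>: "A \<in> sets \<nu> \<longleftrightarrow> A \<in> sets sphere_measure \<and> A \<subseteq> closure \<Omega>"
  by (auto simp: \<nu>_def sets_restrict_space_iff[OF closure_sets(2)])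

lemma emeasure_\<nu>_le: "A \<in> sets \<nu> \<Longrightarrow> emeasure \<nu> A \<le> ennreal Gmax * emeasure sphere_measure A"
proof -
  assume A: "A \<in> sets \<nu>"
  then have A': "A \<in> sets M" by (simp add: \<nu>_def)
  have "emeasure \<nu> A = (\<integral>\<^sup>+x. ennreal (g x) * indicator A x \<partial>M)"
    unfolding \<nu>_def using A' g_measurable by (intro emeasure_density) auto
  also have "\<dots> \<le> (\<integral>\<^sup>+x. ennreal Gmax * indicator A x \<partial>M)"
  proof (rule nn_integral_mono_AE)
    show "AE x in M. ennreal (g x) * indicator A x \<le> ennreal Gmax * indicator A x"
      using Gmax_bound by eventually_elim (auto intro!: mult_right_mono ennreal_leI)
  qed
  also have "\<dots> = ennreal Gmax * emeasure M A" using A' by (simp add: nn_integral_cmult_indicator)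
  also have "emeasure M A = emeasure sphere_measure A"
    using A by (intro emeasure_restrict_space closure_sets) (simp add: sets_\<nu>)
  finally show ?thesis .
qed

lemma finite_measure_\<nu>: "finite_measure \<nu>"
proof (rule finite_measureI)
  have sp: "space \<nu> = closure \<Omega>"
    using closure_subset_S2(1) by (simp add: \<nu>_def space_restrict_space space_sphere_measure Int_absorb2)
  have "emeasure sphere_measure (closure \<Omega>) < \<infinity>"
    using finite_measure.emeasure_finite[OF finite_measure_sphere, of "closure \<Omega>"]
    by (simp add: less_top)
  then have "ennreal Gmax * emeasure sphere_measure (closure \<Omega>) < \<infinity>"
    by (simp add: ennreal_mult_less_top)
  then show "emeasure \<nu> (space \<nu>) \<noteq> \<infinity>"
    using emeasure_\<nu>_le[of "closure \<Omega>"] closure_sets unfolding sp by (auto simp: sets_\<nu> top_unique)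
qed

sublocale \<nu>: finite_measure \<nu> by (rule finite_measure_\<nu>)

lemma measure_\<nu>_le: "A \<in> sets \<nu> \<Longrightarrow> measure \<nu> A \<le> Gmax * measure sphere_measure A"
  using emeasure_\<nu>_le[of A] Gmax_pos
  by (simp add: \<nu>.emeasure_eq_measure finite_measure.emeasure_eq_measure[OF finite_measure_sphere]
      ennreal_mult'[symmetric])

text \<open>In \<open>\<nu>\<close> the function \<open>ennreal\<close> cuts off negative values of
  \<open>g\<close>, which occur only on a null set. Refractor measures, defined by real integrals,
  thus become values of a finite measure.\<close>

lemma set_integral_eq_measure_\<nu>:
  assumes "A \<in> sets \<nu>"
  shows "set_lebesgue_integral sphere_measure A g = measure \<nu> A"
proof -
  have A: "A \<subseteq> closure \<Omega>" "A \<in> sets M" using assms sets_\<nu>[of A] by (auto simp: \<nu>_def)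
  have "set_lebesgue_integral sphere_measure A g = (\<integral>x. indicator A x *\<^sub>R g x \<partial>M)"
    unfolding integral_restrict_space[OF closure_sets(2)] set_lebesgue_integral_def
    by (rule Bochner_Integration.integral_cong) (use A in \<open>auto simp: indicator_def\<close>)
  also have "\<dots> = enn2real (\<integral>\<^sup>+x. ennreal (indicator A x *\<^sub>R g x) \<partial>M)"
    using g_measurable A(2) g_nonneg
    by (intro integral_eq_nn_integral) (auto elim!: eventually_mono simp: indicator_def)
  also have "(\<integral>\<^sup>+x. ennreal (indicator A x *\<^sub>R g x) \<partial>M) = (\<integral>\<^sup>+x. ennreal (g x) * indicator A x \<partial>M)"
    by (rule nn_integral_cong) (auto simp: indicator_def)
  also have "\<dots> = emeasure \<nu> A"
    unfolding \<nu>_def using A g_measurable by (intro emeasure_density[symmetric]) auto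
  finally show ?thesis by (simp add: measure_def)
qed

lemma null_sets_\<nu>:
  assumes "A \<in> null_sets sphere_measure" "A \<subseteq> closure \<Omega>"
  shows "A \<in> null_sets \<nu>"
proof -
  have s: "A \<in> sets \<nu>" using assms by (auto simp: sets_\<nu>)
  have "emeasure \<nu> A \<le> 0" using emeasure_\<nu>_le[OF s] assms by (simp add: null_setsD1)
  then show ?thesis using s by auto
qed

section \<open>Bounds on the directions, and strips between two ellipsoids\<close>

lemma m_unit: "i \<in> {1..N} \<Longrightarrow> norm (m i) = 1"
  using m(1) closure_subset_S2(2) by (auto simp: image_subset_iff subset_iff)

lemma m_inner_ge:
  assumes "i \<in> {1..N}" "x \<in> closure \<Omega>"
  shows "\<kappa> \<le> m i \<bullet> x"
proof -
  have "bdd_below ((\<lambda>(m, x). m \<bullet> x) ` (closure \<Omega>' \<times> closure \<Omega>))"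
  proof (rule bdd_belowI2[where m = "-1"])
    fix p assume "p \<in> closure \<Omega>' \<times> closure \<Omega>"
    then obtain u v where uv: "p = (u, v)" "norm u = 1" "norm v = 1" using closure_subset_S2 by fastforce
    then show "-1 \<le> (case p of (m, x) \<Rightarrow> m \<bullet> x)"
      using norm_cauchy_schwarz[of "-u" v] by simp
  qed
  moreover have "(m i, x) \<in> closure \<Omega>' \<times> closure \<Omega>" using assms m by auto
  ultimately have "(INF (m, x) \<in> closure \<Omega>' \<times> closure \<Omega>. m \<bullet> x) \<le> (case (m i, x) of (m, x) \<Rightarrow> m \<bullet> x)"
    by (rule cINF_lower)
  then show ?thesis using domains by (simp add: refraction_domains_def)
qed

lemma denominator_bounds:
  assumes "i \<in> {1..N}" "x \<in> closure \<Omega>"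
  shows "1 - \<kappa> \<le> 1 - \<kappa> * (m i \<bullet> x)" "1 - \<kappa> * (m i \<bullet> x) \<le> 1 - \<kappa>\<^sup>2" "0 < 1 - \<kappa> * (m i \<bullet> x)"
proof -
  have "norm x = 1" using closure_subset_S2(1) assms by auto
  then have "m i \<bullet> x \<le> 1" using norm_cauchy_schwarz[of "m i" x] m_unit[OF assms(1)] by simp
  then show 1: "1 - \<kappa> \<le> 1 - \<kappa> * (m i \<bullet> x)" using \<kappa> by simp
  then show "0 < 1 - \<kappa> * (m i \<bullet> x)" using \<kappa>(2) by linarith
  show "1 - \<kappa> * (m i \<bullet> x) \<le> 1 - \<kappa>\<^sup>2"
    using m_inner_ge[OF assms] \<kappa> by (simp add: power2_eq_square)
qed

definition strip_const :: "nat \<Rightarrow> nat \<Rightarrow> real" where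
  "strip_const i k = 216 * pi / (\<kappa>^3 * (1 - m i \<bullet> m k)\<^sup>2)"

text \<open>These are the points where an ellipsoid with axis \<open>m i\<close> and parameter
  \<open>s\<close> meets one with axis \<open>m k\<close> and parameter \<open>t\<close>, for some
  positive \<open>s\<close>, \<open>t\<close> with \<open>s / t\<close> in
  \<open>{\<alpha>..\<beta>}\<close>.\<close>

definition strip :: "nat \<Rightarrow> nat \<Rightarrow> real \<Rightarrow> real \<Rightarrow> (real^3) set" where
  "strip i k \<alpha> \<beta> =
    {x \<in> closure \<Omega>. (1 - \<kappa> * (m i \<bullet> x)) / (1 - \<kappa> * (m k \<bullet> x)) \<in> {\<alpha>..\<beta>}}"

lemma strip_const_nonneg: "0 \<le> strip_const i k"
  using \<kappa> by (simp add: strip_const_def)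

lemma strip_borel: "strip i k \<alpha> \<beta> \<in> sets borel"
proof -
  have "strip i k \<alpha> \<beta> = closure \<Omega> \<inter>
    ((\<lambda>x. (1 - \<kappa> * (m i \<bullet> x)) / (1 - \<kappa> * (m k \<bullet> x))) -` {\<alpha>..\<beta>} \<inter> space borel)"
    by (auto simp: strip_def)
  also have "\<dots> \<in> sets borel" by measurable
  finally show ?thesis .
qed

lemma strip_sets: "strip i k \<alpha> \<beta> \<in> sets \<nu>" "strip i k \<alpha> \<beta> \<in> sets sphere_measure"
  using strip_borel[of i k \<alpha> \<beta>] closure_subset_S2(1)
  by (auto simp: sets_\<nu> strip_def intro!: sets_sphere_measure_borel)

lemma measure_strip_le:
  assumes "i \<in> {1..N}" "k \<in> {1..N}" "i \<noteq> k" "\<alpha> < \<beta>"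
  shows "measure sphere_measure (strip i k \<alpha> \<beta>) \<le> strip_const i k * (\<beta> - \<alpha>)"
  unfolding strip_const_def
  using assms m_unit m_inner_ge m(2) closure_subset_S2(1) strip_borel
  by (intro measure_sphere_strip_le \<kappa>) (auto simp: strip_def inj_on_eq_iff)

text \<open>The set lies in strips of width \<open>e\<close> for every positive \<open>e\<close>, so
  its area is 0. Hence ellipsoids with different axes meet only over a null set.\<close>

lemma strip_degenerate_null:
  assumes "i \<in> {1..N}" "k \<in> {1..N}" "i \<noteq> k"
  shows "strip i k \<alpha> \<alpha> \<in> null_sets sphere_measure"
proof -
  let ?K = "strip_const i k"
  have small: "measure sphere_measure (strip i k \<alpha> \<alpha>) \<le> ?K * e" if "0 < e" for e
  proof -
    have "measure sphere_measure (strip i k \<alpha> \<alpha>) \<le> measure sphere_measure (strip i k \<alpha> (\<alpha> + e))"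
      using that by (intro finite_measure.finite_measure_mono[OF finite_measure_sphere] strip_sets)
        (auto simp: strip_def)
    also have "\<dots> \<le> ?K * (\<alpha> + e - \<alpha>)" using assms that by (intro measure_strip_le) auto
    finally show ?thesis by simp
  qed
  have "measure sphere_measure (strip i k \<alpha> \<alpha>) \<le> ?K * 0"
  proof (rule tendsto_lowerbound)
    show "((\<lambda>e. ?K * e) \<longlongrightarrow> ?K * 0) (at_right 0)" by (intro tendsto_intros)
    show "\<forall>\<^sub>F e in at_right 0. measure sphere_measure (strip i k \<alpha> \<alpha>) \<le> ?K * e"
      using eventually_at_right_less[of "0::real"] by eventually_elim (rule small)
  qed simp
  then have "measure sphere_measure (strip i k \<alpha> \<alpha>) = 0"
    by (simp add: measure_le_0_iff)
  then show ?thesis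
    using strip_sets by (simp add: null_sets_def finite_measure.emeasure_eq_measure[OF finite_measure_sphere])
qed

section \<open>Faces, tracing sets and conservation of mass\<close>

definition vis :: "(nat \<Rightarrow> real) \<Rightarrow> nat \<Rightarrow> (real^3) set" where
  "vis b i = {x \<in> closure \<Omega>. \<forall>k\<in>{1..N}. ell_radius \<kappa> (m i) (b i) x \<le> ell_radius \<kappa> (m k) (b k) x}"

lemma vis_sets: "vis b i \<in> sets \<nu>"
proof -
  have 1: "{x. ell_radius \<kappa> (m i) (b i) x \<le> ell_radius \<kappa> (m k) (b k) x} \<in> sets borel" for k
    unfolding ell_radius_def by measurable
  have "vis b i = closure \<Omega> \<inter> (\<Inter>k\<in>{1..N}. {x. ell_radius \<kappa> (m i) (b i) x \<le> ell_radius \<kappa> (m k) (b k) x})"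
    by (auto simp: vis_def)
  also have "\<dots> \<in> sets borel" using 1 N by (intro sets.Int sets.finite_INT) auto
  finally show ?thesis using closure_subset_S2(1)
    by (auto simp: sets_\<nu> vis_def intro!: sets_sphere_measure_borel)
qed

lemma ell_radius_eq_iff_strip:
  assumes "i \<in> {1..N}" "k \<in> {1..N}" "x \<in> closure \<Omega>" "0 < \<beta>'"
    "ell_radius \<kappa> (m i) \<beta> x = ell_radius \<kappa> (m k) \<beta>' x"
  shows "x \<in> strip i k (\<beta> / \<beta>') (\<beta> / \<beta>')"
  using assms denominator_bounds(3)[OF assms(1,3)] denominator_bounds(3)[OF assms(2,3)]
  by (simp add: strip_def ell_radius_def field_simps)

lemma poly_refractor_le: "k \<in> {1..N} \<Longrightarrow> poly_refractor \<kappa> N m b x \<le> ell_radius \<kappa> (m k) (b k) x"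
  unfolding poly_refractor_def by (rule Min_le) auto

lemma poly_refractor_attained: "\<exists>k\<in>{1..N}. poly_refractor \<kappa> N m b x = ell_radius \<kappa> (m k) (b k) x"
proof -
  have "poly_refractor \<kappa> N m b x \<in> (\<lambda>i. ell_radius \<kappa> (m i) (b i) x) ` {1..N}"
    unfolding poly_refractor_def using N by (intro Min_in) auto
  then show ?thesis by auto
qed

lemma vis_iff: "i \<in> {1..N} \<Longrightarrow> x \<in> vis b i \<longleftrightarrow> x \<in> closure \<Omega> \<and> poly_refractor \<kappa> N m b x = ell_radius \<kappa> (m i) (b i) x"
  using poly_refractor_le[of i b x] poly_refractor_attained[of b x] poly_refractor_le[of _ b x]
  by (fastforce simp: vis_def intro: antisym)

lemma vis_supports:
  assumes "i \<in> {1..N}" "x \<in> vis b i"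
  shows "supports \<kappa> \<Omega> (m i) (b i) (poly_refractor \<kappa> N m b) x"
  using assms poly_refractor_le by (auto simp: supports_def vis_iff)

lemma vis_cover: "closure \<Omega> = (\<Union>i\<in>{1..N}. vis b i)"
  using poly_refractor_attained by (auto simp: vis_iff)

lemma is_refractor_poly:
  assumes "\<And>i. i \<in> {1..N} \<Longrightarrow> 0 < b i"
  shows "is_refractor \<kappa> \<Omega> \<Omega>' (poly_refractor \<kappa> N m b)"
  unfolding is_refractor_def
proof
  fix x assume "x \<in> closure \<Omega>"
  then obtain i where i: "i \<in> {1..N}" "x \<in> vis b i" using vis_cover by blast
  then show "\<exists>p\<in>closure \<Omega>'. \<exists>c>0. supports \<kappa> \<Omega> p c (poly_refractor \<kappa> N m b) x"
    using vis_supports[OF i] assms m by blast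
qed

text \<open>The tracing set may exceed the face: when the \<open>i\<close>-th ellipsoid stays strictly above the surface,
  a smaller coaxial one still supports it. Contact then happens only where two different ellipsoids
  meet, which is a null set.\<close>
lemma G_poly_eq:
  assumes i: "i \<in> {1..N}" and pos: "\<And>k. k \<in> {1..N} \<Longrightarrow> 0 < b k"
  shows "G_poly \<kappa> \<Omega> g N m b i = measure \<nu> (vis b i)"
proof -
  let ?\<rho> = "poly_refractor \<kappa> N m b"
  define T where "T = tracing \<kappa> \<Omega> ?\<rho> (m i)"
  have sub: "vis b i \<subseteq> T"
    using vis_supports[OF i] pos[OF i] by (auto simp: T_def tracing_def vis_def)
  have null: "T - vis b i \<in> null_sets sphere_measure"
  proof (cases "T \<subseteq> vis b i")
    case False
    then obtain x0 where x0: "x0 \<in> T" by auto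
    then obtain \<beta>0 where \<beta>0: "0 < \<beta>0" "supports \<kappa> \<Omega> (m i) \<beta>0 ?\<rho> x0" "x0 \<in> closure \<Omega>"
      by (auto simp: T_def tracing_def)
    have "T - vis b i \<subseteq> (\<Union>k\<in>{1..N} - {i}. strip i k (\<beta>0 / b k) (\<beta>0 / b k))"
    proof
      fix x assume x: "x \<in> T - vis b i"
      then obtain \<beta> where \<beta>: "0 < \<beta>" "supports \<kappa> \<Omega> (m i) \<beta> ?\<rho> x" "x \<in> closure \<Omega>"
        by (auto simp: T_def tracing_def)
      \<comment> \<open>Each of the two coaxial ellipsoids is above the contact point of the other,
        so their parameters agree, and a single \<open>\<beta>0\<close> serves all contact
        points.\<close>
      have "ell_radius \<kappa> (m i) \<beta> x \<le> ell_radius \<kappa> (m i) \<beta>0 x" "ell_radius \<kappa> (m i) \<beta>0 x0 \<le> ell_radius \<kappa> (m i) \<beta> x0"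
        using \<beta> \<beta>0 by (auto simp: supports_def)
      then have "\<beta> = \<beta>0"
        using denominator_bounds(3)[OF i \<beta>(3)] denominator_bounds(3)[OF i \<beta>0(3)]
        by (simp add: ell_radius_def divide_le_cancel)
      obtain k where k: "k \<in> {1..N}" "?\<rho> x = ell_radius \<kappa> (m k) (b k) x"
        using poly_refractor_attained by blast
      have "k \<noteq> i" using k x \<beta>(3) by (auto simp: vis_iff)
      moreover have "x \<in> strip i k (\<beta>0 / b k) (\<beta>0 / b k)"
        using ell_radius_eq_iff_strip[OF i k(1) \<beta>(3) pos[OF k(1)], of \<beta>] \<beta> k(2) \<open>\<beta> = \<beta>0\<close>
        by (simp add: supports_def)
      ultimately show "x \<in> (\<Union>k\<in>{1..N} - {i}. strip i k (\<beta>0 / b k) (\<beta>0 / b k))" using k by blast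
    qed
    moreover have "(\<Union>k\<in>{1..N} - {i}. strip i k (\<beta>0 / b k) (\<beta>0 / b k)) \<in> null_sets sphere_measure"
      using i by (intro null_sets_UN' strip_degenerate_null) (auto intro: countable_finite)
    ultimately show ?thesis by (rule null_sets_sphere_subset[rotated])
  qed (simp add: Diff_eq_empty_iff[THEN iffD2])
  have Tcl: "T \<subseteq> closure \<Omega>" by (auto simp: T_def tracing_def)
  then have null\<nu>: "T - vis b i \<in> null_sets \<nu>" using null by (intro null_sets_\<nu>) auto
  have T: "T = vis b i \<union> (T - vis b i)" using sub by auto
  have "vis b i \<union> (T - vis b i) \<in> sets \<nu>" by (rule sets.Un[OF vis_sets null_setsD2[OF null\<nu>]])
  then have "T \<in> sets \<nu>" using T by simp
  then have "G_poly \<kappa> \<Omega> g N m b i = measure \<nu> T"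
    by (simp add: G_poly_def refractor_measure_def T_def[symmetric] set_integral_eq_measure_\<nu>)
  also have "\<dots> = measure \<nu> (vis b i)"
    by (subst T) (rule measure_Un_null_set[OF vis_sets null\<nu>])
  finally show ?thesis .
qed

lemma vis_overlap:
  assumes "i \<in> {1..N}" "k \<in> {1..N}" "0 < b k"
  shows "vis b i \<inter> vis b k \<subseteq> strip i k (b i / b k) (b i / b k)"
  using assms ell_radius_eq_iff_strip[of i k _ "b k" "b i"] by (auto simp: vis_iff simp del: atLeastAtMost_iff)

text \<open>The faces cover the closure, and two of them share, through ties, only points of a
  degenerate strip, which is null.\<close>

lemma sum_measure_vis:
  assumes pos: "\<And>k. k \<in> {1..N} \<Longrightarrow> 0 < b k"
  shows "(\<Sum>i=1..N. measure \<nu> (vis b i)) = measure \<nu> (closure \<Omega>)"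
proof -
  have "AE x in \<nu>. x \<notin> vis b i \<or> x \<notin> vis b k" if ik: "i \<in> {1..N}" "k \<in> {1..N}" "i \<noteq> k" for i k
  proof -
    have "strip i k (b i / b k) (b i / b k) \<in> null_sets \<nu>"
      using strip_degenerate_null[OF ik] by (rule null_sets_\<nu>) (auto simp: strip_def)
    then have "AE x in \<nu>. x \<notin> strip i k (b i / b k) (b i / b k)" by (rule AE_not_in)
    then show ?thesis
      by eventually_elim (use vis_overlap[of i k b, OF ik(1,2) pos[OF ik(2)]] in auto)
  qed
  then have "measure \<nu> (\<Union>i\<in>{1..N}. vis b i) = (\<Sum>i=1..N. measure \<nu> (vis b i))"
    by (intro measure_UNION_AE) (auto simp: pairwise_def \<nu>.fmeasurable_eq_sets vis_sets)
  then show ?thesis unfolding vis_cover[of b, symmetric] by (rule sym)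
qed

section \<open>Effect of lowering one coordinate\<close>

lemma ell_radius_mono:
  "i \<in> {1..N} \<Longrightarrow> x \<in> closure \<Omega> \<Longrightarrow> s \<le> t \<Longrightarrow> ell_radius \<kappa> (m i) s x \<le> ell_radius \<kappa> (m i) t x"
  using denominator_bounds(3)[of i x] by (simp add: ell_radius_def divide_right_mono)

text \<open>Only the comparison with \<open>j\<close> changes, and it becomes stricter.\<close>

lemma vis_decrease_other:
  assumes "j \<in> {1..N}" "c \<le> b j" "i \<noteq> j"
  shows "vis (b(j := c)) i \<subseteq> vis b i"
proof
  fix x assume x: "x \<in> vis (b(j := c)) i"
  then have cl: "x \<in> closure \<Omega>" by (simp add: vis_def)
  have "ell_radius \<kappa> (m i) (b i) x \<le> ell_radius \<kappa> (m k) (b k) x" if k: "k \<in> {1..N}" for k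
  proof -
    have "ell_radius \<kappa> (m i) (b i) x \<le> ell_radius \<kappa> (m k) ((b(j := c)) k) x"
      using x k assms(3) by (auto simp: vis_def)
    also have "\<dots> \<le> ell_radius \<kappa> (m k) (b k) x" using assms k cl by (intro ell_radius_mono) auto
    finally show ?thesis .
  qed
  then show "x \<in> vis b i" using cl by (simp add: vis_def)
qed

lemma vis_decrease_same:
  assumes "j \<in> {1..N}" "c \<le> b j"
  shows "vis b j \<subseteq> vis (b(j := c)) j"
proof
  fix x assume x: "x \<in> vis b j"
  then have cl: "x \<in> closure \<Omega>" by (simp add: vis_def)
  have "ell_radius \<kappa> (m j) c x \<le> ell_radius \<kappa> (m j) (b j) x" using assms cl by (intro ell_radius_mono)
  then show "x \<in> vis (b(j := c)) j" using x by (auto simp: vis_def intro: order_trans)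
qed

text \<open>A point that joins the face had a competitor \<open>k\<close> strictly below the
  ellipsoid with parameter \<open>b j\<close>, but not below the one with \<open>c\<close>. It lies
  in a strip of width \<open>(b j - c) / b k\<close>, and \<open>g\<close> is at most
  \<open>Gmax\<close> almost everywhere.\<close>

lemma measure_vis_increase:
  assumes j: "j \<in> {1..N}" and c: "0 < c" "c < b j" and pos: "\<And>k. k \<in> {1..N} \<Longrightarrow> 0 < b k"
  shows "measure \<nu> (vis (b(j := c)) j)
    \<le> measure \<nu> (vis b j) + Gmax * (\<Sum>k\<in>{1..N} - {j}. strip_const j k / b k) * (b j - c)"
proof -
  let ?S = "\<lambda>k. strip j k (c / b k) (b j / b k)"
  have sub: "vis (b(j := c)) j \<subseteq> vis b j \<union> (\<Union>k\<in>{1..N} - {j}. ?S k)"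
  proof
    fix x assume x: "x \<in> vis (b(j := c)) j"
    then have cl: "x \<in> closure \<Omega>" by (simp add: vis_def)
    show "x \<in> vis b j \<union> (\<Union>k\<in>{1..N} - {j}. ?S k)"
    proof (cases "x \<in> vis b j")
      case False
      then obtain k where k: "k \<in> {1..N}" "ell_radius \<kappa> (m k) (b k) x < ell_radius \<kappa> (m j) (b j) x"
        using cl by (auto simp: vis_def not_le)
      then have "k \<noteq> j" by auto
      with x k have k2: "ell_radius \<kappa> (m j) c x \<le> ell_radius \<kappa> (m k) (b k) x"
        by (auto simp: vis_def dest!: bspec[of _ _ k])
      have "x \<in> ?S k"
        using k(2) k2 denominator_bounds(3)[OF j cl] denominator_bounds(3)[OF k(1) cl] pos[OF k(1)] cl
        by (simp add: strip_def ell_radius_def field_simps)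
      then show ?thesis using k \<open>k \<noteq> j\<close> by blast
    qed simp
  qed
  have "measure \<nu> (vis (b(j := c)) j) \<le> measure \<nu> (vis b j \<union> (\<Union>k\<in>{1..N} - {j}. ?S k))"
    by (intro \<nu>.finite_measure_mono sub sets.Un sets.finite_UN vis_sets strip_sets) auto
  also have "\<dots> \<le> measure \<nu> (vis b j) + measure \<nu> (\<Union>k\<in>{1..N} - {j}. ?S k)"
    by (intro measure_Un_le sets.finite_UN vis_sets strip_sets) auto
  also have "measure \<nu> (\<Union>k\<in>{1..N} - {j}. ?S k) \<le> (\<Sum>k\<in>{1..N} - {j}. measure \<nu> (?S k))"
    by (intro measure_UNION_le strip_sets) auto
  also have "\<dots> \<le> (\<Sum>k\<in>{1..N} - {j}. Gmax * (strip_const j k / b k) * (b j - c))"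
  proof (rule sum_mono)
    fix k assume k: "k \<in> {1..N} - {j}"
    then have bk: "0 < b k" using pos by auto
    have "measure \<nu> (?S k) \<le> Gmax * measure sphere_measure (?S k)" by (rule measure_\<nu>_le[OF strip_sets(1)])
    also have "\<dots> \<le> Gmax * (strip_const j k * (b j / b k - c / b k))"
      using j k bk c Gmax_pos by (intro mult_left_mono measure_strip_le) (auto simp: divide_strict_right_mono)
    also have "\<dots> = Gmax * (strip_const j k / b k) * (b j - c)"
      using bk by (simp add: field_simps)
    finally show "measure \<nu> (?S k) \<le> Gmax * (strip_const j k / b k) * (b j - c)" .
  qed
  also have "\<dots> = Gmax * (\<Sum>k\<in>{1..N} - {j}. strip_const j k / b k) * (b j - c)"
    by (simp add: sum_distrib_left sum_distrib_right)
  finally show ?thesis by (simp only: add_left_mono)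
qed

text \<open>All denominators lie between \<open>1 - \<kappa>\<close> and 1, so a parameter this
  small keeps the \<open>j\<close>-th ellipsoid from rising above any other in any
  direction.\<close>

lemma vis_eq_closure:
  assumes j: "j \<in> {1..N}" and c: "\<And>k. k \<in> {1..N} \<Longrightarrow> c \<le> (1 - \<kappa>) * b k" and "0 < c"
  shows "vis (b(j := c)) j = closure \<Omega>"
proof -
  have "ell_radius \<kappa> (m j) c x \<le> ell_radius \<kappa> (m k) (b k) x" if cl: "x \<in> closure \<Omega>" and k: "k \<in> {1..N}" for x k
  proof -
    have "0 < (1 - \<kappa>) * b k" using c[OF k] \<open>0 < c\<close> by linarith
    then have bk: "0 < b k" using \<kappa> by (simp add: zero_less_mult_iff)
    have "c / (1 - \<kappa> * (m j \<bullet> x)) \<le> c / (1 - \<kappa>)"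
      using denominator_bounds[OF j cl] \<kappa> \<open>0 < c\<close> by (intro divide_left_mono) auto
    also have "\<dots> \<le> b k" using c[OF k] \<kappa> by (simp add: field_simps)
    also have "\<dots> \<le> b k / (1 - \<kappa> * (m k \<bullet> x))"
    proof -
      have "0 \<le> \<kappa> * (m k \<bullet> x)" using m_inner_ge[OF k cl] \<kappa> by simp
      then show ?thesis using denominator_bounds(3)[OF k cl] bk by (simp add: pos_le_divide_eq mult_left_le)
    qed
    finally show ?thesis by (simp add: ell_radius_def)
  qed
  then show ?thesis by (auto simp: vis_def)
qed

text \<open>The intermediate value theorem is applied to the face measure as a function of
  \<open>c\<close>: it is Lipschitz, equals the whole mass at the left end \<open>c0\<close> by
  \<open>vis_eq_closure\<close>, and is below \<open>v\<close> at the right end.\<close>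

lemma measure_vis_attains:
  assumes j: "j \<in> {1..N}" and pos: "\<And>k. k \<in> {1..N} \<Longrightarrow> 0 < b k"
    and v: "measure \<nu> (vis b j) < v" "v \<le> measure \<nu> (closure \<Omega>)"
  shows "\<exists>c. 0 < c \<and> c < b j \<and> measure \<nu> (vis (b(j := c)) j) = v"
proof -
  define \<phi> where "\<phi> c = measure \<nu> (vis (b(j := c)) j)" for c
  define L where "L = Gmax * (\<Sum>k\<in>{1..N} - {j}. strip_const j k / b k)"
  define c0 where "c0 = (1 - \<kappa>) * Min (b ` {1..N})"
  have "Min (b ` {1..N}) \<in> b ` {1..N}" using N by (intro Min_in) auto
  then have Minpos: "0 < Min (b ` {1..N})" using pos by auto
  then have c0: "0 < c0" using \<kappa> by (simp add: c0_def)
  have Minle: "Min (b ` {1..N}) \<le> b k" if "k \<in> {1..N}" for k using that by simp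
  have "c0 \<le> Min (b ` {1..N})" using Minpos \<kappa> by (simp add: c0_def mult_le_cancel_right1)
  then have c0b: "c0 \<le> b j" using Minle[OF j] by linarith
  have L: "0 \<le> L"
    unfolding L_def using Gmax_pos pos strip_const_nonneg
    by (intro mult_nonneg_nonneg sum_nonneg divide_nonneg_pos) auto
  have \<phi>: "\<phi> s \<le> \<phi> t + L * (t - s)" "\<phi> t \<le> \<phi> s" if "0 < s" "s < t" for s t
  proof -
    have t: "b(j := t, j := s) = b(j := s)" by simp
    \<comment> \<open>The sum omits the index \<open>j\<close>, so one constant \<open>L\<close>
      serves for all values of the \<open>j\<close>-th coordinate.\<close>
    have "(\<Sum>k\<in>{1..N} - {j}. strip_const j k / (b(j := t)) k) = (\<Sum>k\<in>{1..N} - {j}. strip_const j k / b k)"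
      by (rule sum.cong) auto
    then show "\<phi> s \<le> \<phi> t + L * (t - s)"
      using measure_vis_increase[OF j, of s "b(j := t)"] that pos unfolding t \<phi>_def L_def by auto
    show "\<phi> t \<le> \<phi> s"
      unfolding \<phi>_def using vis_decrease_same[OF j, of s "b(j := t)"] that unfolding t
      by (intro \<nu>.finite_measure_mono vis_sets) auto
  qed
  have lip: "\<bar>\<phi> s - \<phi> t\<bar> \<le> L * \<bar>s - t\<bar>" if "0 < s" "0 < t" for s t
    using \<phi>[of s t] \<phi>[of t s] that by (cases s t rule: linorder_cases) auto
  have "continuous_on {c0..b j} \<phi>"
    by (rule lipschitz_on_continuous_on[where L = L], rule lipschitz_onI)
      (use lip c0 L in \<open>auto simp: dist_real_def\<close>)
  moreover have "\<phi> c0 = measure \<nu> (closure \<Omega>)"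
    unfolding \<phi>_def using \<kappa> c0 Minle by (subst vis_eq_closure[OF j]) (auto simp: c0_def mult_left_mono)
  moreover have \<phi>b: "\<phi> (b j) = measure \<nu> (vis b j)" by (simp add: \<phi>_def)
  ultimately obtain c where c: "c0 \<le> c" "c \<le> b j" "\<phi> c = v"
    using IVT2'[of \<phi> "b j" v c0] v c0b by auto
  then have "c \<noteq> b j" using v \<phi>b by auto
  then show ?thesis using c c0 by (intro exI[of _ c]) (auto simp: \<phi>_def)
qed

text \<open>On the face of \<open>i\<close>, the quotient \<open>b i / b k\<close> is at most the
  ratio of two denominators lying in \<open>{1 - \<kappa>..1 - \<kappa>\<^sup>2}\<close>, hence at
  most \<open>1 + \<kappa>\<close>.\<close>

lemma vis_nonempty_lower_bound:
  assumes "x \<in> vis b i" "i \<in> {1..N}" "k \<in> {1..N}" "0 < b i"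
  shows "b i / (1 + \<kappa>) \<le> b k"
proof -
  have cl: "x \<in> closure \<Omega>" using assms(1) by (simp add: vis_def)
  note d = denominator_bounds[OF assms(2) cl] denominator_bounds[OF assms(3) cl]
  have "b i / (1 + \<kappa>) = (1 - \<kappa>) * (b i / (1 - \<kappa>\<^sup>2))"
  proof -
    have "1 - \<kappa>\<^sup>2 = (1 - \<kappa>) * (1 + \<kappa>)" by (simp add: power2_eq_square algebra_simps)
    then show ?thesis using \<kappa> by simp
  qed
  also have "\<dots> \<le> (1 - \<kappa> * (m k \<bullet> x)) * (b i / (1 - \<kappa> * (m i \<bullet> x)))"
    using d assms(4) by (intro mult_mono divide_left_mono) auto
  also have "\<dots> \<le> (1 - \<kappa> * (m k \<bullet> x)) * (b k / (1 - \<kappa> * (m k \<bullet> x)))"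
    using d assms(1,3) by (intro mult_left_mono) (auto simp: vis_def ell_radius_def)
  also have "\<dots> = b k" using d by simp
  finally show ?thesis .
qed

end

section \<open>The iterative scheme\<close>

locale refractor_scheme = refraction +
  fixes f :: "nat \<Rightarrow> real" and \<delta> :: real
  assumes f_sum: "set_lebesgue_integral sphere_measure (closure \<Omega>) g = (\<Sum>i=1..N. f i)"
    and \<delta>_pos: "0 < \<delta>" and N\<delta>: "\<And>i. i \<in> {1..N} \<Longrightarrow> real N * \<delta> < f i"
begin

abbreviation W where "W \<equiv> admissible \<kappa> \<Omega> g N m f \<delta>"
abbreviation G where "G \<equiv> G_poly \<kappa> \<Omega> g N m"
abbreviation stp where "stp \<equiv> scheme_step \<kappa> \<Omega> g N m f \<delta>"

section \<open>Admissible vectors\<close>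

lemma W_pos: "b \<in> W \<Longrightarrow> k \<in> {1..N} \<Longrightarrow> 0 < b k"
  by (auto simp: admissible_def PiE_iff)

lemma W_1: "b \<in> W \<Longrightarrow> b 1 = 1"
  by (simp add: admissible_def)

lemma W_G_le: "b \<in> W \<Longrightarrow> i \<in> {2..N} \<Longrightarrow> G b i \<le> f i + \<delta>"
  by (simp add: admissible_def)

lemma G_eq: "b \<in> W \<Longrightarrow> i \<in> {1..N} \<Longrightarrow> G b i = measure \<nu> (vis b i)"
  by (rule G_poly_eq) (auto intro: W_pos)

lemma total_mass: "measure \<nu> (closure \<Omega>) = (\<Sum>i=1..N. f i)"
  using f_sum set_integral_eq_measure_\<nu>[of "closure \<Omega>"] closure_sets by (simp add: sets_\<nu>)

lemma sum_split_first: "(\<Sum>i=1..N. (h i :: real)) = h 1 + (\<Sum>i=2..N. h i)"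
  using N by (simp add: sum.atLeast_Suc_atMost numeral_2_eq_2)

lemma sum_G:
  assumes "b \<in> W"
  shows "(\<Sum>i=1..N. G b i) = (\<Sum>i=1..N. f i)"
proof -
  have "(\<Sum>i=1..N. G b i) = (\<Sum>i=1..N. measure \<nu> (vis b i))"
    by (rule sum.cong) (use G_eq[OF assms] in auto)
  also have "\<dots> = measure \<nu> (closure \<Omega>)" using W_pos[OF assms] by (rule sum_measure_vis)
  finally show ?thesis by (simp add: total_mass)
qed

text \<open>The first ellipsoid receives at least \<open>f\<^sub>1 - (N - 1) \<delta> > 0\<close>, so its face is nonempty.\<close>
lemma W_lower_bound:
  assumes b: "b \<in> W" and k: "k \<in> {1..N}"
  shows "1 / (1 + \<kappa>) \<le> b k"
proof -
  have 1: "1 \<in> {1..N}" using N by simp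
  have "(\<Sum>i=2..N. G b i) \<le> (\<Sum>i=2..N. f i + \<delta>)" by (rule sum_mono) (rule W_G_le[OF b])
  also have "\<dots> = (\<Sum>i=2..N. f i) + real (N - 1) * \<delta>" by (simp add: sum.distrib)
  also have "\<dots> \<le> (\<Sum>i=2..N. f i) + real N * \<delta>" using \<delta>_pos by simp
  finally have "0 < G b 1"
    using sum_G[OF b] N\<delta>[OF 1] unfolding sum_split_first by linarith
  then have "vis b 1 \<noteq> {}" using G_eq[OF b 1] by auto
  then obtain x where "x \<in> vis b 1" by auto
  from vis_nonempty_lower_bound[OF this 1 k] show ?thesis using W_1[OF b] by simp
qed

text \<open>A Lipschitz constant common to all admissible \<open>b\<close> and all \<open>j\<close>:
  the factor \<open>1 + \<kappa>\<close> bounds \<open>1 / b k\<close>, and the sum over all pairs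
  dominates the sum for each single \<open>j\<close>.\<close>

definition \<Lambda> where
  "\<Lambda> = Gmax * ((1 + \<kappa>) * (\<Sum>j=1..N. \<Sum>k\<in>{1..N} - {j}. strip_const j k))"

lemma \<Lambda>_nonneg: "0 \<le> \<Lambda>"
  unfolding \<Lambda>_def using Gmax_pos \<kappa> strip_const_nonneg
  by (intro mult_nonneg_nonneg sum_nonneg) auto

lemma G_increase_W:
  assumes b: "b \<in> W" and j: "j \<in> {1..N}" and c: "0 < c" "c < b j"
  shows "measure \<nu> (vis (b(j := c)) j) \<le> G b j + \<Lambda> * (b j - c)"
proof -
  have "(\<Sum>k\<in>{1..N} - {j}. strip_const j k / b k) \<le> (\<Sum>k\<in>{1..N} - {j}. (1 + \<kappa>) * strip_const j k)"
  proof (rule sum_mono)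
    fix k assume "k \<in> {1..N} - {j}"
    then have k: "0 < b k" "1 / (1 + \<kappa>) \<le> b k" using W_pos[OF b] W_lower_bound[OF b] by auto
    then have "1 \<le> (1 + \<kappa>) * b k" using \<kappa> by (simp add: field_simps)
    then have "strip_const j k * 1 \<le> strip_const j k * ((1 + \<kappa>) * b k)"
      by (intro mult_left_mono strip_const_nonneg)
    then show "strip_const j k / b k \<le> (1 + \<kappa>) * strip_const j k"
      using k by (simp add: pos_divide_le_eq mult_ac)
  qed
  also have "\<dots> = (1 + \<kappa>) * (\<Sum>k\<in>{1..N} - {j}. strip_const j k)" by (simp add: sum_distrib_left)
  also have "\<dots> \<le> (1 + \<kappa>) * (\<Sum>j=1..N. \<Sum>k\<in>{1..N} - {j}. strip_const j k)"
    using \<kappa> j by (intro mult_left_mono member_le_sum) (auto intro!: sum_nonneg strip_const_nonneg)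
  finally have "Gmax * (\<Sum>k\<in>{1..N} - {j}. strip_const j k / b k) * (b j - c) \<le> \<Lambda> * (b j - c)"
    unfolding \<Lambda>_def using Gmax_pos c by (intro mult_right_mono mult_left_mono) auto
  then show ?thesis
    using measure_vis_increase[of j c b, OF j c W_pos[OF b]] G_eq[OF b j] by simp
qed

text \<open>When the \<open>j\<close>-th value is too small, the exact value \<open>f j\<close> can
  be reached, since it is at most the total mass.\<close>

lemma step_exists:
  assumes b: "b \<in> W" and j: "j \<in> {2..N}"
  shows "\<exists>b'. stp j b b'"
proof (cases "f j - \<delta> \<le> G b j")
  case True
  then show ?thesis using W_G_le[OF b j] by (auto simp: scheme_step_def)
next
  case False
  have j1: "j \<in> {1..N}" using j by auto
  have fpos: "0 < f i" if "i \<in> {1..N}" for i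
    using N\<delta>[OF that] \<delta>_pos N by (smt (verit) mult_nonneg_nonneg of_nat_0_le_iff)
  have "f j \<le> (\<Sum>i=1..N. f i)" using j1 fpos by (intro member_le_sum) (auto intro: less_imp_le)
  then have "\<exists>c. 0 < c \<and> c < b j \<and> measure \<nu> (vis (b(j := c)) j) = f j"
    using False G_eq[OF b j1] \<delta>_pos by (intro measure_vis_attains[OF j1 W_pos[OF b]]) (auto simp: total_mass)
  then obtain c where c: "0 < c" "c < b j" "measure \<nu> (vis (b(j := c)) j) = f j" by auto
  have "G (b(j := c)) j = f j"
    using c W_pos[OF b] by (subst G_poly_eq[OF j1]) auto
  then show ?thesis using c False \<delta>_pos
    by (intro exI[of _ "b(j := c)"]) (auto simp: scheme_step_def)
qed

section \<open>The potential and its decrease under a step\<close>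

definition \<Phi> :: "(nat \<Rightarrow> real) \<Rightarrow> real" where "\<Phi> b = (\<Sum>i=1..N. b i)"

text \<open>Lowering coordinate \<open>j\<close> shrinks the other faces, so admissibility persists.
  A proper step lifts the \<open>j\<close>-th value from below \<open>f j - \<delta>\<close> to at
  least \<open>f j\<close>, and \<open>G_increase_W\<close> turns this gain into a decrease of
  \<open>\<Phi>\<close>. The product form avoids dividing by \<open>\<Lambda>\<close>, for which
  \<open>\<Lambda>_nonneg\<close> gives only nonnegativity.\<close>

lemma step_properties:
  assumes b: "b \<in> W" and j: "j \<in> {2..N}" and st: "stp j b b'"
  shows "b' \<in> W" "(if b' = b then 0 else \<delta>) \<le> \<Lambda> * (\<Phi> b - \<Phi> b')"
    "b' = b \<Longrightarrow> f j - \<delta> \<le> G b j"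
proof -
  have j1: "j \<in> {1..N}" using j by auto
  consider "b' = b" "f j - \<delta> \<le> G b j" | c where "G b j < f j - \<delta>" "0 < c" "c < b j" "b' = b(j := c)"
      "f j \<le> G b' j" "G b' j \<le> f j + \<delta>"
    using st W_G_le[OF b j] by (auto simp: scheme_step_def split: if_splits)
  then have "b' \<in> W \<and> (if b' = b then 0 else \<delta>) \<le> \<Lambda> * (\<Phi> b - \<Phi> b') \<and> (b' = b \<longrightarrow> f j - \<delta> \<le> G b j)"
  proof cases
    case 1
    then show ?thesis using b by simp
  next
    case (2 c)
    have pos: "0 < b' k" if "k \<in> {1..N}" for k using 2 W_pos[OF b that] by simp
    have "G b' i \<le> f i + \<delta>" if i: "i \<in> {2..N}" for i
    proof (cases "i = j")
      case False
      have i1: "i \<in> {1..N}" using i by auto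
      have "G b' i = measure \<nu> (vis b' i)" by (rule G_poly_eq[OF i1 pos])
      also have "\<dots> \<le> measure \<nu> (vis b i)"
        using vis_decrease_other[OF j1, of c b i] 2 False by (intro \<nu>.finite_measure_mono vis_sets) auto
      also have "\<dots> = G b i" by (rule G_eq[OF b i1, symmetric])
      finally show ?thesis using W_G_le[OF b i] by simp
    qed (use 2 in simp)
    moreover have "b' \<in> {1..N} \<rightarrow>\<^sub>E {0<..}"
      using b j1 2 by (auto simp: admissible_def PiE_iff extensional_def)
    moreover have "b' 1 = 1" using 2 j W_1[OF b] by simp
    ultimately have W': "b' \<in> W" by (simp add: admissible_def)
    have "G b' j \<le> G b j + \<Lambda> * (b j - c)"
      using G_increase_W[OF b j1] 2 G_eq[OF W' j1] by simp
    moreover have "\<Phi> b - \<Phi> b' = b j - c"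
      using j1 2(4) by (simp add: \<Phi>_def sum.remove[of _ j])
    ultimately have "\<delta> \<le> \<Lambda> * (\<Phi> b - \<Phi> b')" using 2 by simp
    moreover have "b' \<noteq> b" using 2 by (metis fun_upd_same less_irrefl)
    ultimately show ?thesis using W' by simp
  qed
  then show "b' \<in> W" "(if b' = b then 0 else \<delta>) \<le> \<Lambda> * (\<Phi> b - \<Phi> b')"
    "b' = b \<Longrightarrow> f j - \<delta> \<le> G b j" by auto
qed

lemma step_eq_if_accurate:
  assumes "b \<in> W" "j \<in> {2..N}"
  shows "stp j b b' \<and> f j - \<delta> \<le> G b j \<Longrightarrow> b' = b"
  using W_G_le[OF assms] by (simp add: scheme_step_def)

text \<open>The bound \<open>1 \<le> j\<close> is carried through the induction because it places
  \<open>Suc j\<close> in \<open>{2..N}\<close>, the range of the treated coordinates.\<close>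

lemma reach_W:
  assumes "scheme_reach \<kappa> \<Omega> g N m f \<delta> b0 n j b" "b0 \<in> W"
  shows "b \<in> W \<and> 1 \<le> j"
  using assms
proof induction
  case (step n j b b')
  then show ?case using step_properties(1)[of b "Suc j" b'] by auto
qed auto

lemma seq_exists:
  assumes "b0 \<in> W"
  shows "\<exists>B. scheme_seq \<kappa> \<Omega> g N m f \<delta> b0 B"
proof -
  define nx where "nx j b = (SOME b'. stp j b b')" for j b
  have nx: "stp j b (nx j b)" if "b \<in> W" "j \<in> {2..N}" for j b
    unfolding nx_def using step_exists[OF that] by (rule someI_ex)
  \<comment> \<open>\<open>grp b k\<close> is vector number \<open>k + 1\<close> of a group starting
    with \<open>b\<close>, so passing from \<open>k\<close> to \<open>k + 1\<close> treats
    coordinate \<open>k + 2\<close>.\<close>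
  define grp where "grp b k = rec_nat b (\<lambda>i. nx (Suc (Suc i))) k" for b k
  have grp: "grp b 0 = b" "grp b (Suc k) = nx (Suc (Suc k)) (grp b k)" for b k
    by (simp_all add: grp_def)
  have grpW: "grp b k \<in> W" if "b \<in> W" "k < N" for b k
    using that(2)
  proof (induction k)
    case (Suc k)
    then show ?case
      using step_properties(1)[of "grp b k" "Suc (Suc k)"] nx[of "grp b k" "Suc (Suc k)"] by (simp add: grp)
  qed (use that in \<open>simp add: grp\<close>)
  \<comment> \<open>\<open>st n\<close> is the first vector of group \<open>n + 1\<close>.\<close>
  define st where "st n = ((\<lambda>b. grp b (N - 1)) ^^ n) b0" for n
  have stW: "st n \<in> W" for n
    by (induction n) (use assms grpW[of _ "N - 1"] N in \<open>auto simp: st_def\<close>)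
  define B where "B n j = grp (st (n - 1)) (j - 1)" for n j
  have "scheme_seq \<kappa> \<Omega> g N m f \<delta> b0 B"
    unfolding scheme_seq_def
  proof (intro conjI allI impI ballI)
    show "B 1 1 = b0" by (simp add: B_def grp st_def)
    show "B (n + 1) 1 = B n N" if "1 \<le> n" for n
      using that by (cases n) (auto simp: B_def grp st_def)
    show "stp j (B n (j - 1)) (B n j)" if n: "1 \<le> n" and j: "j \<in> {2..N}" for n j
    proof -
      obtain k where k: "j = Suc (Suc k)" using j by (metis atLeastAtMost_iff numeral_2_eq_2 le_Suc_ex plus_nat.simps(2))
      then have "grp (st (n - 1)) k \<in> W" using j by (intro grpW stW) auto
      then show ?thesis using nx[of "grp (st (n - 1)) k" j] j by (simp add: B_def k grp)
    qed
  qed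
  then show ?thesis by blast
qed

section \<open>Analysis of one infinite run\<close>

context
  fixes b0 B
  assumes b0: "b0 \<in> W" and seq: "scheme_seq \<kappa> \<Omega> g N m f \<delta> b0 B"
begin

lemma seq_start: "B 1 1 = b0" and seq_next: "1 \<le> n \<Longrightarrow> B (Suc n) 1 = B n N"
  and seq_step: "1 \<le> n \<Longrightarrow> Suc j \<in> {2..N} \<Longrightarrow> stp (Suc j) (B n j) (B n (Suc j))"
proof -
  show "B 1 1 = b0" using seq by (simp add: scheme_seq_def)
  show "B (Suc n) 1 = B n N" if "1 \<le> n" using seq that by (simp add: scheme_seq_def)
  show "stp (Suc j) (B n j) (B n (Suc j))" if "1 \<le> n" "Suc j \<in> {2..N}"
  proof -
    have "stp (Suc j) (B n (Suc j - 1)) (B n (Suc j))" using seq that unfolding scheme_seq_def by blast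
    then show ?thesis by simp
  qed
qed

lemma group_W: "1 \<le> n \<Longrightarrow> B n 1 \<in> W \<Longrightarrow> j \<in> {1..N} \<Longrightarrow> B n j \<in> W"
proof (induction j)
  case (Suc j)
  show ?case
  proof (cases "j = 0")
    case False
    then have "B n j \<in> W" "Suc j \<in> {2..N}" using Suc by auto
    then show ?thesis using seq_step[of n j] step_properties(1) Suc.prems by blast
  qed (use Suc in simp)
qed simp

lemma seq_W: "1 \<le> n \<Longrightarrow> j \<in> {1..N} \<Longrightarrow> B n j \<in> W"
proof (induction n arbitrary: j rule: dec_induct)
  case base
  then show ?case using group_W[of 1] seq_start b0 by auto
next
  case (step n)
  then have "B (Suc n) 1 \<in> W" using seq_next[of n] N by simp
  then show ?case using group_W[of "Suc n"] step by auto
qed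

definition const_group where "const_group n \<longleftrightarrow> (\<forall>j\<in>{1..N}. B n j = B n 1)"

lemma const_groupD: "const_group n \<Longrightarrow> j \<in> {1..N} \<Longrightarrow> B n j = B n 1"
  unfolding const_group_def by (rule bspec)

text \<open>The step estimates telescope over the group; the first vector that differs from
  \<open>B n 1\<close> arises by a proper step and contributes \<open>\<delta>\<close>.\<close>

lemma group_potential:
  assumes n: "1 \<le> n"
  shows "(if const_group n then 0 else \<delta>) \<le> \<Lambda> * (\<Phi> (B n 1) - \<Phi> (B (Suc n) 1))"
proof -
  define P where "P j \<longleftrightarrow> (\<forall>i\<in>{1..j}. B n i = B n 1)" for j
  have pot: "(if P j then 0 else \<delta>) \<le> \<Lambda> * (\<Phi> (B n 1) - \<Phi> (B n j))" if "j \<in> {1..N}" for j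
    using that
  proof (induction j)
    case (Suc j)
    show ?case
    proof (cases "j = 0")
      case True
      have "P (Suc 0)" by (simp add: P_def)
      then show ?thesis using True by simp
    next
      case False
      then have j: "j \<in> {1..N}" "Suc j \<in> {2..N}" using Suc.prems by auto
      let ?x = "\<Lambda> * (\<Phi> (B n 1) - \<Phi> (B n j))" and ?y = "\<Lambda> * (\<Phi> (B n j) - \<Phi> (B n (Suc j)))"
      have x: "(if P j then 0 else \<delta>) \<le> ?x" by (rule Suc.IH[OF j(1)])
      have y: "(if B n (Suc j) = B n j then 0 else \<delta>) \<le> ?y"
        by (rule step_properties(2)[OF seq_W[OF n j(1)] j(2) seq_step[OF n j(2)]])
      have P: "P (Suc j)" if "P j" "B n (Suc j) = B n j"
        using that j(1) unfolding P_def by (metis atLeastAtMost_iff le_Suc_eq order_refl)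
      \<comment> \<open>If \<open>P j\<close> fails, then \<open>?x\<close> is at least
        \<open>\<delta>\<close> and \<open>?y\<close> is nonnegative; if the change occurs at
        \<open>Suc j\<close>, then \<open>?y\<close> is at least \<open>\<delta>\<close>.\<close>
      have "(if P (Suc j) then 0 else \<delta>) \<le> ?x + ?y"
        using x y P \<delta>_pos by (cases "P j"; cases "B n (Suc j) = B n j"; cases "P (Suc j)"; simp)
      also have "?x + ?y = \<Lambda> * (\<Phi> (B n 1) - \<Phi> (B n (Suc j)))" by (simp add: right_diff_distrib)
      finally show ?thesis .
    qed
  qed simp
  have "N \<in> {1..N}" using N by simp
  from pot[OF this] show ?thesis unfolding seq_next[OF n] P_def const_group_def .
qed

text \<open>A proper step changes the vector, so in a constant group every treated coordinate passed
  the accuracy test.\<close>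

lemma const_group_G:
  assumes n: "1 \<le> n" and c: "const_group n" and j: "j \<in> {2..N}"
  shows "f j - \<delta> \<le> G (B n 1) j"
proof -
  have "j - 1 \<in> {1..N}" "j \<in> {1..N}" using j by auto
  then have "B n (j - 1) = B n 1" "B n j = B n 1" using const_groupD[OF c] by blast+
  moreover have "stp j (B n (j - 1)) (B n j)" using seq n j unfolding scheme_seq_def by blast
  ultimately have "stp j (B n 1) (B n 1)" by (simp only:)
  moreover have "B n 1 \<in> W" using seq_W[OF n, of 1] N by simp
  ultimately show ?thesis using step_properties(3)[of "B n 1" j "B n 1"] j by blast
qed

text \<open>All treated coordinates are already accurate, and then the rule leaves no choice but to
  keep the vector.\<close>

lemma const_group_next:
  assumes n: "1 \<le> n" and c: "const_group n" and j: "j \<in> {1..N}"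
  shows "B (Suc n) j = B n 1"
  using j
proof (induction j)
  case (Suc j)
  show ?case
  proof (cases "j = 0")
    case True
    have "B n N = B n 1" by (rule const_groupD[OF c]) (use N in simp)
    then show ?thesis using True seq_next[OF n] by simp
  next
    case False
    then have j: "Suc j \<in> {2..N}" and IH: "B (Suc n) j = B n 1" using Suc by auto
    have "stp (Suc j) (B n 1) (B (Suc n) (Suc j))" using seq_step[of "Suc n" j] j IH by simp
    then show ?thesis
      using step_eq_if_accurate[OF _ j] const_group_G[OF n c j] seq_W[OF n, of 1] N by simp
  qed
qed simp

lemma const_group_forever:
  assumes n: "1 \<le> n" and c: "const_group n" and "n \<le> k"
  shows "\<forall>j\<in>{1..N}. B k j = B n 1"
  using \<open>n \<le> k\<close>
proof (induction k rule: dec_induct)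
  case base
  then show ?case using const_groupD[OF c] by blast
next
  case (step k)
  then have IH: "B k j = B n 1" if "j \<in> {1..N}" for j using that by blast
  have k1: "B k 1 = B n 1" using IH[of 1] N by simp
  have "const_group k" unfolding const_group_def k1 using IH by blast
  then show ?case using const_group_next[of k] step(1) n k1 by (metis order_trans)
qed

text \<open>Coordinates from 2 on are within \<open>\<delta>\<close> by the accuracy test. The first
  is never treated, but conservation of mass bounds its error by the sum of the other
  \<open>N - 1\<close> errors.\<close>

lemma const_group_accuracy:
  assumes n: "1 \<le> n" and c: "const_group n" and \<epsilon>: "real N * \<delta> \<le> \<epsilon>" and i: "i \<in> {1..N}"
  shows "\<bar>G (B n 1) i - f i\<bar> \<le> \<epsilon>"
proof -
  have W: "B n 1 \<in> W" using seq_W[OF n] N by simp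
  have 2: "\<bar>G (B n 1) i - f i\<bar> \<le> \<delta>" if "i \<in> {2..N}" for i
    using const_group_G[OF n c that] W_G_le[OF W that] by linarith
  show ?thesis
  proof (cases "i = 1")
    case True
    have "G (B n 1) 1 - f 1 = (\<Sum>i=2..N. f i - G (B n 1) i)"
      using sum_G[OF W] unfolding sum_split_first by (simp add: sum_subtractf)
    also have "\<bar>\<dots>\<bar> \<le> (\<Sum>i=2..N. \<delta>)"
      using 2 by (intro order_trans[OF sum_abs] sum_mono) (simp add: abs_minus_commute)
    also have "\<dots> \<le> real N * \<delta>" using \<delta>_pos by simp
    finally show ?thesis using \<epsilon> True by simp
  next
    case False
    have "1 * \<delta> \<le> real N * \<delta>" using N \<delta>_pos by (intro mult_right_mono) auto
    then show ?thesis using 2[of i] i False \<epsilon> by simp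
  qed
qed

text \<open>The group estimates telescope. Only \<open>N - 1\<close> coordinates contribute to the
  drop of \<open>\<Phi>\<close>, as the first stays 1, and each ends at
  \<open>1 / (1 + \<kappa>)\<close> or above.\<close>

lemma nonconst_groups_bound:
  assumes "\<And>n. n \<in> {1..K} \<Longrightarrow> \<not> const_group n"
  shows "real K * \<delta> \<le> \<Lambda> * ((real N - 1) * (MAX j\<in>{2..N}. b0 j - 1 / (1 + \<kappa>)))"
proof -
  have "real K * \<delta> \<le> \<Lambda> * (\<Phi> b0 - \<Phi> (B (Suc K) 1))"
    using assms
  proof (induction K)
    case 0
    then show ?case using seq_start by simp
  next
    case (Suc K)
    have "\<delta> \<le> \<Lambda> * (\<Phi> (B (Suc K) 1) - \<Phi> (B (Suc (Suc K)) 1))"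
      using group_potential[of "Suc K"] Suc.prems[of "Suc K"] by simp
    moreover have "real K * \<delta> \<le> \<Lambda> * (\<Phi> b0 - \<Phi> (B (Suc K) 1))"
      using Suc.prems by (intro Suc.IH) auto
    moreover have "real (Suc K) * \<delta> = real K * \<delta> + \<delta>" by (simp add: distrib_right)
    ultimately show ?case unfolding right_diff_distrib by linarith
  qed
  also have "\<dots> \<le> \<Lambda> * ((real N - 1) * (MAX j\<in>{2..N}. b0 j - 1 / (1 + \<kappa>)))"
  proof (rule mult_left_mono[OF _ \<Lambda>_nonneg])
    have W: "B (Suc K) 1 \<in> W" using seq_W N by simp
    have "\<Phi> b0 - \<Phi> (B (Suc K) 1) = (\<Sum>i=2..N. b0 i - B (Suc K) 1 i)"
      unfolding \<Phi>_def sum_split_first using W_1[OF W] W_1[OF b0] by (simp add: sum_subtractf)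
    also have "\<dots> \<le> (\<Sum>i=2..N. (MAX j\<in>{2..N}. b0 j - 1 / (1 + \<kappa>)))"
    proof (rule sum_mono)
      fix i assume i: "i \<in> {2..N}"
      then have "b0 i - 1 / (1 + \<kappa>) \<le> (MAX j\<in>{2..N}. b0 j - 1 / (1 + \<kappa>))" by (intro Max_ge) auto
      moreover have "1 / (1 + \<kappa>) \<le> B (Suc K) 1 i" using W_lower_bound[OF W] i by simp
      ultimately show "b0 i - B (Suc K) 1 i \<le> (MAX j\<in>{2..N}. b0 j - 1 / (1 + \<kappa>))" by linarith
    qed
    also have "\<dots> = (real N - 1) * (MAX j\<in>{2..N}. b0 j - 1 / (1 + \<kappa>))" using N by (simp add: of_nat_diff)
    finally show "\<Phi> b0 - \<Phi> (B (Suc K) 1) \<le> (real N - 1) * (MAX j\<in>{2..N}. b0 j - 1 / (1 + \<kappa>))" .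
  qed
  finally show ?thesis .
qed

text \<open>Otherwise the preceding bound would hold for every \<open>K\<close>, against the
  Archimedean property.\<close>

lemma const_group_exists: "\<exists>n\<ge>1. const_group n"
proof (rule ccontr)
  assume "\<not> ?thesis"
  then have "real K * \<delta> \<le> \<Lambda> * ((real N - 1) * (MAX j\<in>{2..N}. b0 j - 1 / (1 + \<kappa>)))" for K
    by (intro nonconst_groups_bound) auto
  then show False using reals_Archimedean3[OF \<delta>_pos] by (meson not_less)
qed

lemma eventually_const_bound:
  "\<exists>(n0 :: nat) b. (\<forall>n\<ge>1. n0 \<le> n \<longrightarrow> (\<forall>j\<in>{1..N}. B n j = b)) \<and>
    real n0 \<le> 2 * (\<Lambda> * ((real N - 1) * (MAX j\<in>{2..N}. b0 j - 1 / (1 + \<kappa>))) / \<delta>)"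
proof -
  define R where "R = \<Lambda> * ((real N - 1) * (MAX j\<in>{2..N}. b0 j - 1 / (1 + \<kappa>)))"
  define n1 where "n1 = (LEAST n. 1 \<le> n \<and> const_group n)"
  have n1: "1 \<le> n1" "const_group n1"
    using LeastI_ex[OF const_group_exists[unfolded Bex_def]] by (auto simp: n1_def)
  have "\<not> const_group n" if "n \<in> {1..n1 - 1}" for n
  proof -
    have "1 \<le> n" "n < n1" using that n1(1) by auto
    then show ?thesis
      using not_less_Least[of n "\<lambda>n. 1 \<le> n \<and> const_group n"] unfolding n1_def[symmetric] by blast
  qed
  then have K: "real (n1 - 1) * \<delta> \<le> R" unfolding R_def by (rule nonconst_groups_bound)
  have forever: "\<forall>j\<in>{1..N}. B n j = B n1 1" if "n1 \<le> n" for n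
    by (rule const_group_forever[OF n1 that])
  \<comment> \<open>For \<open>n1 = 1\<close> the bound is only shown to be nonnegative, so
    \<open>n0\<close> is 0, which says the same because groups are numbered from 1. Otherwise
    \<open>n1 \<le> 2 * (n1 - 1)\<close>, and \<open>n1 - 1\<close> counts the preceding nonconstant
    groups.\<close>
  obtain n0 :: nat where n0: "\<And>n. 1 \<le> n \<Longrightarrow> n0 \<le> n \<Longrightarrow> n1 \<le> n" "real n0 \<le> 2 * (R / \<delta>)"
  proof (cases "n1 = 1")
    case True
    then have "0 \<le> R / \<delta>" using K \<delta>_pos by simp
    then show thesis using True by (intro that[of 0]) auto
  next
    case False
    have "real (n1 - 1) \<le> R / \<delta>" using K \<delta>_pos by (simp add: pos_le_divide_eq)
    then have "real n1 \<le> 2 * (R / \<delta>)" using False n1(1) by linarith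
    then show thesis by (intro that[of n1])
  qed
  have "\<forall>n\<ge>1. n0 \<le> n \<longrightarrow> (\<forall>j\<in>{1..N}. B n j = B n1 1)"
    using n0(1) forever by blast
  then show ?thesis using n0(2) unfolding R_def by blast
qed

end

end

theorem mainTheorem1:
  shows "\<exists>C :: real \<Rightarrow> nat \<Rightarrow> (nat \<Rightarrow> nat \<Rightarrow> real) \<Rightarrow> real.
    \<forall>(\<kappa> :: real) (\<Omega> :: (real^3) set) (\<Omega>' :: (real^3) set) (g :: real^3 \<Rightarrow> real)
     (N :: nat) (f :: nat \<Rightarrow> real) (m :: nat \<Rightarrow> real^3) (\<epsilon> :: real) (\<delta> :: real) (b0 :: nat \<Rightarrow> real).
      0 < \<kappa> \<and> \<kappa> < 1 \<and>
      refraction_domains \<kappa> \<Omega> \<Omega>' \<and>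
      ess_bounded (restrict_space sphere_measure (closure \<Omega>)) g \<and>
      (AE x in restrict_space sphere_measure (closure \<Omega>). 0 \<le> g x) \<and>
      2 \<le> N \<and>
      (\<forall>i\<in>{1..N}. 0 < f i) \<and>
      set_lebesgue_integral sphere_measure (closure \<Omega>) g = (\<Sum>i=1..N. f i) \<and>
      m ` {1..N} \<subseteq> closure \<Omega>' \<and> inj_on m {1..N} \<and>
      0 < \<epsilon> \<and>
      0 < \<delta> \<and> \<delta> < (MIN i\<in>{1..N}. f i) / real N \<and> \<delta> \<le> \<epsilon> / real N \<and>
      b0 \<in> admissible \<kappa> \<Omega> g N m f \<delta>
      \<longrightarrow>
      (\<forall>n j b. scheme_reach \<kappa> \<Omega> g N m f \<delta> b0 n j b \<longrightarrow>
         b \<in> admissible \<kappa> \<Omega> g N m f \<delta> \<and>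
         (j < N \<longrightarrow> (\<exists>b'. scheme_step \<kappa> \<Omega> g N m f \<delta> (j + 1) b b'))) \<and>
      (\<exists>B. scheme_seq \<kappa> \<Omega> g N m f \<delta> b0 B) \<and>
      (\<forall>B. scheme_seq \<kappa> \<Omega> g N m f \<delta> b0 B \<longrightarrow>
         (\<forall>n\<ge>1. \<forall>j\<in>{1..N}. B n j \<in> admissible \<kappa> \<Omega> g N m f \<delta>) \<and>
         (\<exists>n\<ge>1. \<forall>j\<in>{1..N}. B n j = B n 1) \<and>
         (\<forall>n\<ge>1. (\<forall>j\<in>{1..N}. B n j = B n 1) \<longrightarrow>
            is_refractor \<kappa> \<Omega> \<Omega>' (poly_refractor \<kappa> N m (B n 1)) \<and>
            (\<forall>i\<in>{1..N}. \<bar>G_poly \<kappa> \<Omega> g N m (B n 1) i - f i\<bar> \<le> \<epsilon>)) \<and>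
         (\<exists>(n0 :: nat) (b :: nat \<Rightarrow> real).
            (\<forall>n\<ge>1. n0 \<le> n \<longrightarrow> (\<forall>j\<in>{1..N}. B n j = b)) \<and>
            real n0 \<le> real N
              * ((1 + \<kappa>) * C \<kappa> N (angle_table N m) * ess_sup_on \<Omega> g * (real N - 1) / \<delta>)
              * (MAX j\<in>{2..N}. b0 j - 1 / (1 + \<kappa>))))"
proof -
  \<comment> \<open>The cosine of a tabulated angle recovers \<open>m i \<bullet> m k\<close>, so
    the summands are the strip constants, expressed through \<open>\<kappa>\<close> and the angles
    alone.\<close>
  define C :: "real \<Rightarrow> nat \<Rightarrow> (nat \<Rightarrow> nat \<Rightarrow> real) \<Rightarrow> real" where
    "C \<kappa> N T = 2 * (\<Sum>i=1..N. \<Sum>k\<in>{1..N} - {i}. 216 * pi / (\<kappa>^3 * (1 - cos (T i k))\<^sup>2))" for \<kappa> N T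
  show ?thesis
  proof (rule exI[of _ C], intro allI impI, elim conjE)
    fix \<kappa> :: real and \<Omega> \<Omega>' :: "(real^3) set" and g :: "real^3 \<Rightarrow> real" and N :: nat
      and f :: "nat \<Rightarrow> real" and m :: "nat \<Rightarrow> real^3" and \<epsilon> \<delta> :: real and b0 :: "nat \<Rightarrow> real"
    assume *: "0 < \<kappa>" "\<kappa> < 1" "refraction_domains \<kappa> \<Omega> \<Omega>'"
        "ess_bounded (restrict_space sphere_measure (closure \<Omega>)) g"
        "AE x in restrict_space sphere_measure (closure \<Omega>). 0 \<le> g x"
        "2 \<le> N" "\<forall>i\<in>{1..N}. 0 < f i"
        "set_lebesgue_integral sphere_measure (closure \<Omega>) g = (\<Sum>i=1..N. f i)"
        "m ` {1..N} \<subseteq> closure \<Omega>'" "inj_on m {1..N}" "0 < \<epsilon>" "0 < \<delta>"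
        "\<delta> < (MIN i\<in>{1..N}. f i) / real N" "\<delta> \<le> \<epsilon> / real N"
        "b0 \<in> admissible \<kappa> \<Omega> g N m f \<delta>"
    have "0 < (\<Sum>i=1..N. f i)" using *(6,7) by (intro sum_pos) auto
    moreover have "real N * \<delta> < f i" if i: "i \<in> {1..N}" for i
    proof -
      have "real N * \<delta> < (MIN i\<in>{1..N}. f i)" using *(6,13) by (simp add: pos_less_divide_eq mult.commute)
      also have "\<dots> \<le> f i" using i by (intro Min_le) auto
      finally show ?thesis .
    qed
    ultimately interpret refractor_scheme \<kappa> \<Omega> \<Omega>' g N m f \<delta>
      using * by unfold_locales auto
    have N\<epsilon>: "real N * \<delta> \<le> \<epsilon>" using *(6,14) by (simp add: pos_le_divide_eq mult.commute)
    have table: "216 * pi / (\<kappa>^3 * (1 - cos (angle_table N m i k))\<^sup>2) = strip_const i k"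
      if "i \<in> {1..N}" "k \<in> {1..N}" for i k
      using that Cauchy_Schwarz_ineq2[of "m i" "m k"] m_unit[OF that(1)] m_unit[OF that(2)]
      by (simp add: angle_table_def strip_const_def cos_arccos_abs)
    have "(\<Sum>i=1..N. \<Sum>k\<in>{1..N} - {i}. 216 * pi / (\<kappa>^3 * (1 - cos (angle_table N m i k))\<^sup>2))
        = (\<Sum>i=1..N. \<Sum>k\<in>{1..N} - {i}. strip_const i k)"
      by (intro sum.cong refl table) auto
    then have C: "(1 + \<kappa>) * C \<kappa> N (angle_table N m) * ess_sup_on \<Omega> g = 2 * \<Lambda>"
      by (simp add: C_def \<Lambda>_def)
    let ?Mx = "MAX j\<in>{2..N}. b0 j - 1 / (1 + \<kappa>)"
    show "(\<forall>n j b. scheme_reach \<kappa> \<Omega> g N m f \<delta> b0 n j b \<longrightarrow> b \<in> W \<and> (j < N \<longrightarrow> (\<exists>b'. stp (j + 1) b b'))) \<and>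
      (\<exists>B. scheme_seq \<kappa> \<Omega> g N m f \<delta> b0 B) \<and>
      (\<forall>B. scheme_seq \<kappa> \<Omega> g N m f \<delta> b0 B \<longrightarrow>
         (\<forall>n\<ge>1. \<forall>j\<in>{1..N}. B n j \<in> W) \<and>
         (\<exists>n\<ge>1. \<forall>j\<in>{1..N}. B n j = B n 1) \<and>
         (\<forall>n\<ge>1. (\<forall>j\<in>{1..N}. B n j = B n 1) \<longrightarrow>
            is_refractor \<kappa> \<Omega> \<Omega>' (poly_refractor \<kappa> N m (B n 1)) \<and>
            (\<forall>i\<in>{1..N}. \<bar>G (B n 1) i - f i\<bar> \<le> \<epsilon>)) \<and>
         (\<exists>(n0 :: nat) (b :: nat \<Rightarrow> real).
            (\<forall>n\<ge>1. n0 \<le> n \<longrightarrow> (\<forall>j\<in>{1..N}. B n j = b)) \<and>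
            real n0 \<le> real N
              * ((1 + \<kappa>) * C \<kappa> N (angle_table N m) * ess_sup_on \<Omega> g * (real N - 1) / \<delta>)
              * ?Mx))"
    proof (intro conjI allI impI)
      fix n j b assume r: "scheme_reach \<kappa> \<Omega> g N m f \<delta> b0 n j b"
      show "b \<in> W" using reach_W[OF r *(15)] ..
      show "\<exists>b'. stp (j + 1) b b'" if "j < N"
        using reach_W[OF r *(15)] that by (intro step_exists) auto
    next
      show "\<exists>B. scheme_seq \<kappa> \<Omega> g N m f \<delta> b0 B" by (rule seq_exists[OF *(15)])
    next
      fix B assume B: "scheme_seq \<kappa> \<Omega> g N m f \<delta> b0 B"
      note run = *(15) B
      show "\<forall>j\<in>{1..N}. B n j \<in> W" if "1 \<le> n" for n using seq_W[OF run that] by blast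
      show "\<exists>n\<ge>1. \<forall>j\<in>{1..N}. B n j = B n 1"
        using const_group_exists[OF run] unfolding const_group_def[OF run] .
      fix n :: nat assume n: "1 \<le> n" and c: "\<forall>j\<in>{1..N}. B n j = B n 1"
      have "B n 1 \<in> W" using seq_W[OF run n] N by simp
      then show "is_refractor \<kappa> \<Omega> \<Omega>' (poly_refractor \<kappa> N m (B n 1))"
        using W_pos by (intro is_refractor_poly)
      show "\<forall>i\<in>{1..N}. \<bar>G (B n 1) i - f i\<bar> \<le> \<epsilon>"
        using const_group_accuracy[OF run n _ N\<epsilon>] c unfolding const_group_def[OF run] by blast
    next
      fix B assume B: "scheme_seq \<kappa> \<Omega> g N m f \<delta> b0 B"
      obtain n0 :: nat and b where n0: "\<forall>n\<ge>1. n0 \<le> n \<longrightarrow> (\<forall>j\<in>{1..N}. B n j = b)"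
        "real n0 \<le> 2 * (\<Lambda> * ((real N - 1) * ?Mx) / \<delta>)"
        using eventually_const_bound[OF *(15) B] by blast
      let ?X = "2 * (\<Lambda> * ((real N - 1) * ?Mx) / \<delta>)"
      \<comment> \<open>\<open>C\<close> contains a factor 2 since \<open>K + 1 \<le> 2 K\<close> for the number \<open>K \<ge> 1\<close> of groups that are not constant.\<close>
      have "1 * ?X \<le> real N * ?X" using n0(2) N by (intro mult_right_mono) linarith+
      also have "\<dots> = real N * (2 * \<Lambda> * (real N - 1) / \<delta>) * ?Mx" by (simp add: mult_ac)
      finally have "real n0 \<le> real N * (2 * \<Lambda> * (real N - 1) / \<delta>) * ?Mx" using n0(2) by linarith
      then show "\<exists>(n0 :: nat) b. (\<forall>n\<ge>1. n0 \<le> n \<longrightarrow> (\<forall>j\<in>{1..N}. B n j = b)) \<and>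
          real n0 \<le> real N
            * ((1 + \<kappa>) * C \<kappa> N (angle_table N m) * ess_sup_on \<Omega> g * (real N - 1) / \<delta>) * ?Mx"
        using n0(1) unfolding C by blast
    qed
  qed
qed

end
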